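(* Let $K_\mu$ be an integral operator on $L^2(S^2,d\mu)$, $(K_\mu\psi)(x)=\int_{S^2}K(x,y)\psi(y)\,d\mu(y)$, with integral kernel $K\in C^0(S^2\times S^2,\mathbb{R})$ having the following properties: (a) $K(x,y)\le L(x,y)$ for all $x,y\in S^2$; (b) the operator $K_\mu$ is positive. Then the minimal action satisfies the estimate $$S_{\min}\ge\iint_{S^2\times S^2}K(x,y)\,d\mu(x)\,d\mu(y).$$
   Context: $S^2\subset\mathbb{R}^3$ is the unit sphere and $\mu$ is the standard volume measure on $S^2$ normalized to total mass one. For a parameter $\tau\ge1$ let $$D(x,y)=2\tau^2\,(1+\langle x,y\rangle)\,\big(2-\tau^2(1-\langle x,y\rangle)\big),\qquad x,y\in S^2,$$ where $\langle\cdot,\cdot\rangle$ is the Euclidean scalar product, and $L=\max(0,D)$. $\mathfrak{M}$ is the set of all normalized (total mass one) positive regular Borel measures on $S^2$; $S[\rho]=\iint_{S^2\times S^2}L(x,y)\,d\rho(x)\,d\rho(y)$ and $S_{\min}=\inf_{\rho\in\mathfrak{M}}S[\rho]$. An operator $A$ on a Hilbert space is called positive if $\langle\psi,A\psi\rangle\ge0$ for all $\psi$. *)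

theory Defs
  imports "HOL-Analysis.Analysis"
begin

abbreviation S2 :: "(real^3) set"
  where "S2 \<equiv> sphere 0 1"

abbreviation borel_S2 :: "(real^3) measure"
  where "borel_S2 \<equiv> restrict_space borel S2"

definition spherical_coords :: "real \<times> real \<Rightarrow> real^3"
  where "spherical_coords = (\<lambda>(\<theta>, \<phi>). vector [sin \<theta> * cos \<phi>, sin \<theta> * sin \<phi>, cos \<theta>])"

text \<open>
  The normalized volume measure of the unit sphere. In the coordinates \<open>(\<theta>, \<phi>)\<close>, which cover
  the sphere up to a null set, the round metric is \<open>d\<theta>\<^sup>2 + (sin \<theta>)\<^sup>2 d\<phi>\<^sup>2\<close>, so that the volume
  measure is \<open>sin \<theta> d\<theta> d\<phi>\<close>; its total mass is \<open>4 \<pi>\<close>.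
\<close>

definition vol_S2 :: "(real^3) measure"
  where "vol_S2 =
    distr
      (density lborel
        (\<lambda>(\<theta>, \<phi>). ennreal (indicator ({0..pi} \<times> {0..2 * pi}) (\<theta>, \<phi>) * sin \<theta> / (4 * pi))))
      borel_S2 spherical_coords"

definition causal_D :: "real \<Rightarrow> real^3 \<Rightarrow> real^3 \<Rightarrow> real"
  where "causal_D \<tau> x y = 2 * \<tau>\<^sup>2 * (1 + x \<bullet> y) * (2 - \<tau>\<^sup>2 * (1 - x \<bullet> y))"

definition lagrangian :: "real \<Rightarrow> real^3 \<Rightarrow> real^3 \<Rightarrow> real"
  where "lagrangian \<tau> x y = max 0 (causal_D \<tau> x y)"

definition regular_borel_S2 :: "(real^3) measure \<Rightarrow> bool"
  where "regular_borel_S2 \<rho> \<longleftrightarrow>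
    sets \<rho> = sets borel_S2 \<and>
    (\<forall>A\<in>sets \<rho>.
      emeasure \<rho> A = (INF U\<in>{U. openin (top_of_set S2) U \<and> A \<subseteq> U}. emeasure \<rho> U) \<and>
      emeasure \<rho> A = (SUP C\<in>{C. compact C \<and> C \<subseteq> A}. emeasure \<rho> C))"

definition normalized_measures_S2 :: "(real^3) measure set"
  where "normalized_measures_S2 = {\<rho>. regular_borel_S2 \<rho> \<and> emeasure \<rho> S2 = 1}"

definition double_integral :: "'a measure \<Rightarrow> ('a \<Rightarrow> 'a \<Rightarrow> real) \<Rightarrow> real"
  where "double_integral M k = (\<integral>(x, y). k x y \<partial>(M \<Otimes>\<^sub>M M))"

definition action :: "real \<Rightarrow> (real^3) measure \<Rightarrow> real"
  where "action \<tau> \<rho> = double_integral \<rho> (lagrangian \<tau>)"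

definition min_action :: "real \<Rightarrow> real"
  where "min_action \<tau> = (INF \<rho>\<in>normalized_measures_S2. action \<tau> \<rho>)"

text \<open>
  Elements of the (real) Hilbert space \<open>L\<^sup>2\<close> are represented by functions, without passing to the
  quotient by almost-everywhere equality; the inner product only depends on the classes.
\<close>

definition L2 :: "'a measure \<Rightarrow> ('a \<Rightarrow> real) set"
  where "L2 M = {\<psi> \<in> borel_measurable M. integrable M (\<lambda>x. (\<psi> x)\<^sup>2)}"

definition L2_inner :: "'a measure \<Rightarrow> ('a \<Rightarrow> real) \<Rightarrow> ('a \<Rightarrow> real) \<Rightarrow> real"
  where "L2_inner M f g = (\<integral>x. f x * g x \<partial>M)"

definition integral_operator ::
    "'a measure \<Rightarrow> ('a \<Rightarrow> 'a \<Rightarrow> real) \<Rightarrow> ('a \<Rightarrow> real) \<Rightarrow> ('a \<Rightarrow> real)"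
  where "integral_operator M k \<psi> = (\<lambda>x. \<integral>y. k x y * \<psi> y \<partial>M)"

definition positive_operator :: "'a measure \<Rightarrow> (('a \<Rightarrow> real) \<Rightarrow> ('a \<Rightarrow> real)) \<Rightarrow> bool"
  where "positive_operator M A \<longleftrightarrow> (\<forall>\<psi>\<in>L2 M. 0 \<le> L2_inner M \<psi> (A \<psi>))"

end

theory Submission imports Defs begin

text \<open>
  For a normalized measure \<open>\<sigma>\<close> on the sphere, positivity of the operator extends, by mollifying \<open>\<sigma>\<close>
  into a continuous density, from functions to the signed measure \<open>\<sigma> - \<mu>\<close>:
  \<open>\<integral>\<integral>K d\<sigma>d\<sigma> \<ge> \<integral>k d\<sigma> - \<integral>\<integral>K d\<mu>d\<mu>\<close> with \<open>k x = \<integral>K(x,y) d\<mu>(y) + \<integral>K(y,x) d\<mu>(y)\<close>.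
  Since \<open>K\<close> need not be rotation invariant, this is applied to a rotated copy \<open>\<sigma> = g\<rho>\<close>, which has
  the same action as \<open>\<rho>\<close>. The mean of \<open>\<integral>k d(g\<rho>)\<close> over the rotations is
  \<open>\<integral>k d\<mu> = 2 \<integral>\<integral>K d\<mu>d\<mu>\<close>, so some \<open>g\<close> gives \<open>S[\<rho>] \<ge> \<integral>\<integral>K d\<sigma>d\<sigma> \<ge> \<integral>\<integral>K d\<mu>d\<mu>\<close>.
  Instead of the Haar measure on the rotation group, the averages run over the new pole and then
  over the angle about it; only the invariance of means of zonal functions \<open>u \<mapsto> h (x \<bullet> u)\<close> is needed.
\<close>

section \<open>Continuous integrands on compact sets\<close>

text \<open>One notion for every measure that occurs: the volume measure, \<open>\<rho>\<close> and
  its rotated copies on the sphere, and Lebesgue measure on the interval of angles. Fixing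
  \<open>sets M\<close> also fixes \<open>space M = S\<close>.\<close>

definition finite_borel_on :: "'a::topological_space set \<Rightarrow> 'a measure \<Rightarrow> bool"
  where "finite_borel_on S M \<longleftrightarrow> finite_measure M \<and> sets M = sets (restrict_space borel S)"

lemma finite_borel_onD:
  assumes "finite_borel_on S M"
  shows "finite_measure M" "sets M = sets (restrict_space borel S)" "space M = S"
  using assms sets_eq_imp_space_eq[of M "restrict_space borel S"]
  by (auto simp: finite_borel_on_def space_restrict_space)

lemma borel_measurable_finite_borel_on:
  fixes f :: "'a::topological_space \<Rightarrow> 'b::topological_space"
  assumes "finite_borel_on S M" "continuous_on S f"
  shows "f \<in> borel_measurable M"
  using borel_measurable_continuous_on_restrict[OF assms(2)] finite_borel_onD(2)[OF assms(1)]
  by (simp cong: measurable_cong_sets)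

lemma integrable_continuous_compact:
  fixes f :: "'a::topological_space \<Rightarrow> real"
  assumes "compact S" "finite_borel_on S M" "continuous_on S f"
  shows "integrable M f"
proof -
  interpret finite_measure M using finite_borel_onD[OF assms(2)] by blast
  have "bounded (f ` S)"
    using assms by (intro compact_imp_bounded compact_continuous_image)
  then obtain B where "\<And>x. x \<in> S \<Longrightarrow> norm (f x) \<le> B"
    by (auto simp: bounded_iff)
  then show ?thesis
    using assms finite_borel_onD[OF assms(2)]
    by (intro integrable_const_bound[where B=B]) (auto intro: borel_measurable_finite_borel_on)
qed

text \<open>Second countability makes the Borel sets of \<open>S \<times> T\<close> those generated
  by rectangles, so functions continuous on \<open>S \<times> T\<close> are measurable for the
  product measure. Each inclusion of sigma-algebras is read off from measurability of the identity
  map.\<close>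

lemma finite_borel_on_pair:
  fixes S :: "'a::second_countable_topology set" and T :: "'b::second_countable_topology set"
  assumes M: "finite_borel_on S M" and N: "finite_borel_on T N"
  shows "finite_borel_on (S \<times> T) (M \<Otimes>\<^sub>M N)"
proof -
  note m = finite_borel_onD[OF M] and n = finite_borel_onD[OF N]
  have "sets (restrict_space borel (S \<times> T)) = sets (M \<Otimes>\<^sub>M N)"
  proof
    have "id \<in> M \<Otimes>\<^sub>M N \<rightarrow>\<^sub>M restrict_space (borel \<Otimes>\<^sub>M borel) (S \<times> T)"
    proof (rule measurable_restrict_space2)
      have "fst \<in> M \<Otimes>\<^sub>M N \<rightarrow>\<^sub>M borel"
        by (rule measurable_compose[OF measurable_fst], rule borel_measurable_finite_borel_on[OF M])
           (intro continuous_intros)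
      moreover have "snd \<in> M \<Otimes>\<^sub>M N \<rightarrow>\<^sub>M borel"
        by (rule measurable_compose[OF measurable_snd], rule borel_measurable_finite_borel_on[OF N])
           (intro continuous_intros)
      ultimately show "id \<in> M \<Otimes>\<^sub>M N \<rightarrow>\<^sub>M borel \<Otimes>\<^sub>M borel"
        by (simp add: measurable_pair_iff o_def)
    qed (auto simp: space_pair_measure m n)
    then have *: "id -` A \<inter> space (M \<Otimes>\<^sub>M N) \<in> sets (M \<Otimes>\<^sub>M N)"
      if "A \<in> sets (restrict_space borel (S \<times> T))" for A
      using that by (intro measurable_sets) (simp_all add: borel_prod)
    show "sets (restrict_space borel (S \<times> T)) \<subseteq> sets (M \<Otimes>\<^sub>M N)"
    proof
      fix A assume A: "A \<in> sets (restrict_space borel (S \<times> T))"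
      with sets.sets_into_space[OF A] have "id -` A \<inter> space (M \<Otimes>\<^sub>M N) = A"
        by (auto simp: space_pair_measure m n space_restrict_space)
      with *[OF A] show "A \<in> sets (M \<Otimes>\<^sub>M N)" by simp
    qed
    let ?P = "restrict_space borel S \<Otimes>\<^sub>M restrict_space borel T :: ('a \<times> 'b) measure"
    have "id \<in> restrict_space (borel \<Otimes>\<^sub>M borel) (S \<times> T) \<rightarrow>\<^sub>M ?P"
      by (auto simp: measurable_pair_iff o_def intro!: measurable_restrict_space3)
    then have *: "id -` A \<inter> space (restrict_space borel (S \<times> T)) \<in> sets (restrict_space borel (S \<times> T))"
      if "A \<in> sets ?P" for A
      using that by (intro measurable_sets[of _ _ ?P]) (simp_all add: borel_prod)
    show "sets (M \<Otimes>\<^sub>M N) \<subseteq> sets (restrict_space borel (S \<times> T))"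
    proof
      fix A assume "A \<in> sets (M \<Otimes>\<^sub>M N)"
      then have A: "A \<in> sets ?P"
        using sets_pair_measure_cong[OF m(2) n(2)] by blast
      with sets.sets_into_space[OF A] have "id -` A \<inter> space (restrict_space borel (S \<times> T)) = A"
        by (auto simp: space_pair_measure space_restrict_space)
      with *[OF A] show "A \<in> sets (restrict_space borel (S \<times> T))" by simp
    qed
  qed
  then show ?thesis
    using finite_measure_pair_measure[OF n(1) m(1)] by (simp add: finite_borel_on_def)
qed

lemma integral_fst_continuous:
  fixes f :: "'a::second_countable_topology \<Rightarrow> 'b::second_countable_topology \<Rightarrow> real"
  assumes "compact S" "compact T" "finite_borel_on S M" "finite_borel_on T N"
    and "continuous_on (S \<times> T) (\<lambda>(x, y). f x y)"
  shows "(\<integral>(x, y). f x y \<partial>(M \<Otimes>\<^sub>M N)) = (\<integral>x. \<integral>y. f x y \<partial>N \<partial>M)"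
proof -
  interpret M: finite_measure M using finite_borel_onD assms by blast
  interpret N: finite_measure N using finite_borel_onD assms by blast
  interpret pair_sigma_finite M N ..
  have "integrable (M \<Otimes>\<^sub>M N) (\<lambda>(x, y). f x y)"
    by (rule integrable_continuous_compact[OF compact_Times finite_borel_on_pair]) fact+
  from integral_fst'[OF this] show ?thesis by simp
qed

lemma integral_swap_continuous_measure:
  fixes f :: "'a::second_countable_topology \<Rightarrow> 'b::second_countable_topology \<Rightarrow> real"
  assumes "compact S" "compact T" "finite_borel_on S M" "finite_borel_on T N"
    and "continuous_on (S \<times> T) (\<lambda>(x, y). f x y)"
  shows "(\<integral>x. \<integral>y. f x y \<partial>N \<partial>M) = (\<integral>y. \<integral>x. f x y \<partial>M \<partial>N)"
proof -
  interpret M: finite_measure M using finite_borel_onD assms by blast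
  interpret N: finite_measure N using finite_borel_onD assms by blast
  interpret pair_sigma_finite M N ..
  have "integrable (M \<Otimes>\<^sub>M N) (\<lambda>(x, y). f x y)"
    by (rule integrable_continuous_compact[OF compact_Times finite_borel_on_pair]) fact+
  from Fubini_integral[OF this] show ?thesis by simp
qed

lemma continuous_on_slices:
  assumes "continuous_on (S \<times> T) (\<lambda>(x, y). f x y)"
  shows "x \<in> S \<Longrightarrow> continuous_on T (\<lambda>y. f x y)" "y \<in> T \<Longrightarrow> continuous_on S (\<lambda>x. f x y)"
proof -
  assume x: "x \<in> S"
  have "continuous_on T (\<lambda>y. (\<lambda>(x, y). f x y) (x, y))"
    by (rule continuous_on_compose2[OF assms]) (use x in \<open>auto intro: continuous_on_Pair\<close>)
  then show "continuous_on T (\<lambda>y. f x y)" by simp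
next
  assume y: "y \<in> T"
  have "continuous_on S (\<lambda>x. (\<lambda>(x, y). f x y) (x, y))"
    by (rule continuous_on_compose2[OF assms]) (use y in \<open>auto intro: continuous_on_Pair\<close>)
  then show "continuous_on S (\<lambda>x. f x y)" by simp
qed

lemma continuous_on_swap_args:
  assumes "continuous_on (S \<times> T) (\<lambda>(x, y). f x y)"
  shows "continuous_on (T \<times> S) (\<lambda>(y, x). f x y)"
proof -
  have "continuous_on (T \<times> S) (\<lambda>z. (snd z, fst z))"
    by (intro continuous_intros)
  then have "continuous_on (T \<times> S) (\<lambda>z. (\<lambda>(x, y). f x y) (snd z, fst z))"
    by (rule continuous_on_compose2[OF assms]) auto
  then show ?thesis by (simp add: split_beta)
qed

lemma abs_integral_diff_le:
  fixes f :: "'a \<Rightarrow> real"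
  assumes "finite_measure M" "integrable M f" "integrable M g"
    and "\<And>x. x \<in> space M \<Longrightarrow> \<bar>f x - g x\<bar> \<le> e"
  shows "\<bar>(\<integral>x. f x \<partial>M) - (\<integral>x. g x \<partial>M)\<bar> \<le> e * measure M (space M)"
proof -
  interpret finite_measure M by fact
  have "\<bar>(\<integral>x. f x \<partial>M) - (\<integral>x. g x \<partial>M)\<bar> = \<bar>\<integral>x. f x - g x \<partial>M\<bar>"
    using assms by simp
  also have "\<dots> \<le> (\<integral>x. \<bar>f x - g x\<bar> \<partial>M)"
    by (rule integral_abs_bound)
  also have "\<dots> \<le> (\<integral>x. e \<partial>M)"
    using assms by (intro integral_mono) auto
  finally show ?thesis by (simp add: mult.commute)
qed

text \<open>By uniform continuity on the compact set \<open>S \<times> T\<close>,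
  \<open>f x' y\<close> is close to \<open>f x y\<close> for all \<open>y\<close> at once, and
  \<open>N\<close> has finite mass.\<close>

lemma continuous_on_integral_param:
  fixes f :: "'a::metric_space \<Rightarrow> 'b::{metric_space, second_countable_topology} \<Rightarrow> real"
  assumes "compact S" "compact T" "finite_borel_on T N"
    and cont: "continuous_on (S \<times> T) (\<lambda>(x, y). f x y)"
  shows "continuous_on S (\<lambda>x. \<integral>y. f x y \<partial>N)"
  unfolding continuous_on_iff
proof (intro ballI allI impI)
  fix x and e :: real assume x: "x \<in> S" and "e > 0"
  note N = finite_borel_onD[OF assms(3)]
  \<comment> \<open>The summand 1 keeps the divisor positive when \<open>N\<close> has mass
    zero.\<close>
  define m where "m = measure N (space N) + 1"
  have m: "m > 0" by (simp add: m_def add_nonneg_pos)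
  have "uniformly_continuous_on (S \<times> T) (\<lambda>(x, y). f x y)"
    using assms by (intro compact_uniformly_continuous compact_Times)
  then obtain d where d: "d > 0"
    "\<And>z z'. z \<in> S \<times> T \<Longrightarrow> z' \<in> S \<times> T \<Longrightarrow> dist z' z < d \<Longrightarrow>
       dist ((\<lambda>(x, y). f x y) z') ((\<lambda>(x, y). f x y) z) < e / (2 * m)"
    unfolding uniformly_continuous_on_def using \<open>e > 0\<close> m
    by (metis divide_pos_pos mult_pos_pos zero_less_numeral)
  show "\<exists>d>0. \<forall>x'\<in>S. dist x' x < d \<longrightarrow> dist (\<integral>y. f x' y \<partial>N) (\<integral>y. f x y \<partial>N) < e"
  proof (intro exI conjI ballI impI)
    fix x' assume x': "x' \<in> S" "dist x' x < d"
    have "\<bar>(\<integral>y. f x' y \<partial>N) - (\<integral>y. f x y \<partial>N)\<bar> \<le> e / (2 * m) * measure N (space N)"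
    proof (rule abs_integral_diff_le)
      fix y assume "y \<in> space N"
      then show "\<bar>f x' y - f x y\<bar> \<le> e / (2 * m)"
        using d(2)[of "(x, y)" "(x', y)"] x x' N by (simp add: dist_real_def dist_Pair_Pair)
    qed (use N x x' assms continuous_on_slices[OF cont] in
          \<open>auto intro: integrable_continuous_compact\<close>)
    also have "\<dots> \<le> e / (2 * m) * m"
      using \<open>e > 0\<close> m by (intro mult_left_mono) (auto simp: m_def)
    also have "\<dots> < e" using m \<open>e > 0\<close> by simp
    finally show "dist (\<integral>y. f x' y \<partial>N) (\<integral>y. f x y \<partial>N) < e"
      by (simp add: dist_real_def)
  qed (use d in auto)
qed

text \<open>A maximum point of \<open>f\<close> serves as \<open>u\<close>. This turns a mean over
  poles or angles into the choice of a single one.\<close>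

lemma integral_le_max_compact:
  fixes f :: "'a::topological_space \<Rightarrow> real"
  assumes "compact S" "S \<noteq> {}" "finite_borel_on S M" "continuous_on S f"
  obtains u where "u \<in> S" "(\<integral>x. f x \<partial>M) \<le> f u * measure M S"
proof -
  obtain u where u: "u \<in> S" "\<And>x. x \<in> S \<Longrightarrow> f x \<le> f u"
    using continuous_attains_sup[OF assms(1,2,4)] by blast
  note m = finite_borel_onD[OF assms(3)]
  interpret finite_measure M by fact
  have "(\<integral>x. f x \<partial>M) \<le> (\<integral>x. f u \<partial>M)"
    using u m assms by (intro integral_mono integrable_continuous_compact[OF assms(1,3)]) auto
  with u m show ?thesis by (intro that[of u]) (auto simp: mult.commute)
qed

section \<open>The volume measure of the sphere\<close>

lemma spherical_coords_nth:
  "spherical_coords z $ 1 = sin (fst z) * cos (snd z)"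
  "spherical_coords z $ 2 = sin (fst z) * sin (snd z)"
  "spherical_coords z $ 3 = cos (fst z)"
  by (simp_all add: spherical_coords_def split_beta vector_3)

lemma inner_real3: "(x :: real^3) \<bullet> y = x $ 1 * y $ 1 + x $ 2 * y $ 2 + x $ 3 * y $ 3"
  by (simp add: inner_vec_def sum_3)

lemma norm_eq_1_real3: "norm (x :: real^3) = 1 \<longleftrightarrow> (x $ 1)\<^sup>2 + (x $ 2)\<^sup>2 + (x $ 3)\<^sup>2 = 1"
  by (simp add: norm_eq_1 inner_real3 power2_eq_square)

lemma norm_spherical_coords [simp]: "norm (spherical_coords z) = 1"
proof -
  let ?\<theta> = "fst z" and ?\<phi> = "snd z"
  have "(sin ?\<theta> * cos ?\<phi>)\<^sup>2 + (sin ?\<theta> * sin ?\<phi>)\<^sup>2 + (cos ?\<theta>)\<^sup>2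
      = (sin ?\<theta>)\<^sup>2 * ((cos ?\<phi>)\<^sup>2 + (sin ?\<phi>)\<^sup>2) + (cos ?\<theta>)\<^sup>2"
    by (simp only: power_mult_distrib distrib_left)
  also have "\<dots> = 1" by (simp only: sin_cos_squared_add sin_cos_squared_add2 mult_1_right)
  finally show ?thesis by (simp only: norm_eq_1_real3 spherical_coords_nth)
qed

lemma continuous_on_spherical_coords [continuous_intros]: 
  "continuous_on A f \<Longrightarrow> continuous_on A (\<lambda>z. spherical_coords (f z))"
proof -
  have "continuous_on UNIV (\<lambda>z. spherical_coords z $ i)" for i
    using exhaust_3[of i]
    by (elim disjE) (simp_all only: spherical_coords_nth, (intro continuous_intros)+)
  then have "continuous_on UNIV spherical_coords"
    by (subst continuous_on_componentwise) (auto simp: Basis_vec_def inner_axis)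
  then show "continuous_on A f \<Longrightarrow> continuous_on A (\<lambda>z. spherical_coords (f z))"
    by (rule continuous_on_compose2) auto
qed

lemma spherical_coords_measurable: "spherical_coords \<in> borel \<rightarrow>\<^sub>M borel_S2"
  by (intro measurable_restrict_space2 borel_measurable_continuous_onI continuous_intros) auto

definition angle_box :: "(real \<times> real) set"
  where "angle_box = cbox (0, 0) (pi, 2 * pi)"

lemma angle_box_eq: "angle_box = {0..pi} \<times> {0..2 * pi}"
  unfolding angle_box_def cbox_Pair_eq by (simp only: cbox_interval)

lemma integral_angle_box_density:
  "integral angle_box (\<lambda>(\<theta>, \<phi>). sin \<theta> / (4 * pi)) = 1"
proof -
  have "integral angle_box (\<lambda>(\<theta>, \<phi>). sin \<theta> / (4 * pi)) =
      integral (cbox 0 pi) (\<lambda>\<theta>. integral (cbox 0 (2 * pi)) (\<lambda>\<phi>. sin \<theta> / (4 * pi)))"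
    unfolding angle_box_def
    by (subst integral_prod_continuous) (auto simp: split_beta intro!: continuous_intros)
  also have "\<dots> = integral {0..pi} (\<lambda>\<theta>. sin \<theta> / 2)"
    by (simp add: field_simps)
  also have "\<dots> = (- cos pi / 2) - (- cos 0 / 2)"
    by (intro integral_unique fundamental_theorem_of_calculus)
       (auto intro!: derivative_eq_intros simp flip: has_real_derivative_iff_has_vector_derivative)
  finally show ?thesis by simp
qed

lemma integrable_angle_box_density:
  "integrable lborel (\<lambda>z. indicator angle_box z * sin (fst z) / (4 * pi))"
proof -
  have "integrable lborel (\<lambda>z. indicator angle_box z *\<^sub>R (sin (fst z) / (4 * pi)))"
    unfolding angle_box_def by (intro borel_integrable_compact continuous_intros) auto
  then show ?thesis by simp
qed

lemma vol_S2_eq: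
  "vol_S2 = distr (density lborel (\<lambda>z. ennreal (indicator angle_box z * sin (fst z) / (4 * pi))))
      borel_S2 spherical_coords"
  unfolding vol_S2_def angle_box_eq by (simp only: case_prod_unfold prod.collapse)

text \<open>\<open>ennreal\<close> sends negative values to 0; as \<open>sin\<close> is nonnegative
  on the box, the cast in \<open>vol_S2\<close> changes nothing.\<close>

lemma angle_box_density_nonneg: "0 \<le> indicator angle_box z * sin (fst z) / (4 * pi)"
proof (cases "z \<in> angle_box")
  case True
  then have "0 \<le> fst z" "fst z \<le> pi"
    unfolding angle_box_eq by (simp_all add: mem_Times_iff)
  then have "0 \<le> sin (fst z)"
    by (rule sin_ge_zero)
  then show ?thesis by (intro divide_nonneg_pos mult_nonneg_nonneg) auto
qed simp

lemma finite_borel_on_vol_S2: "finite_borel_on S2 vol_S2"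
proof -
  let ?d = "\<lambda>z. indicator angle_box z * sin (fst z) / (4 * pi)"
  have "emeasure vol_S2 (space vol_S2) = (\<integral>\<^sup>+z. ennreal (?d z) \<partial>lborel)"
  proof -
    have "S2 \<in> sets borel_S2"
      using sets.top[of borel_S2] by (simp add: space_restrict_space)
    moreover have "spherical_coords -` S2 = UNIV" by auto
    moreover have "(\<lambda>z. ennreal (?d z)) \<in> borel_measurable lborel"
      using borel_measurable_integrable[OF integrable_angle_box_density] by simp
    ultimately show ?thesis
      using spherical_coords_measurable
      by (simp add: vol_S2_eq emeasure_distr emeasure_density space_restrict_space del: vimage_eq)
  qed
  also have "\<dots> < \<infinity>"
    using integrable_angle_box_density angle_box_density_nonneg
    by (subst nn_integral_eq_integral) auto
  finally show ?thesis
    by (auto simp: finite_borel_on_def vol_S2_def intro!: finite_measureI)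
qed

text \<open>Unfolding the image measure and the density leaves a Lebesgue integral over the box,
  which for a continuous integrand equals the Henstock-Kurzweil integral. There the fundamental
  theorem of calculus and differentiation under the integral sign apply.\<close>

lemma integral_vol_S2:
  fixes f :: "real^3 \<Rightarrow> real"
  assumes f: "continuous_on S2 f"
  shows "(\<integral>u. f u \<partial>vol_S2) = integral angle_box (\<lambda>(\<theta>, \<phi>). f (spherical_coords (\<theta>, \<phi>)) * sin \<theta> / (4 * pi))"
proof -
  have c: "continuous_on A (\<lambda>z. f (spherical_coords z))" for A
    by (rule continuous_on_compose2[OF f]) (auto intro!: continuous_intros)
  have "(\<integral>u. f u \<partial>vol_S2) =
      (\<integral>z. f (spherical_coords z) \<partial>density lborel (\<lambda>z. ennreal (indicator angle_box z * sin (fst z) / (4 * pi))))"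
    using spherical_coords_measurable borel_measurable_continuous_on_restrict[OF f]
    unfolding vol_S2_eq by (intro integral_distr) auto
  also have "\<dots> = (\<integral>z. (indicator angle_box z * sin (fst z) / (4 * pi)) *\<^sub>R f (spherical_coords z) \<partial>lborel)"
  proof (rule integral_density)
    show "(\<lambda>z. f (spherical_coords z)) \<in> borel_measurable lborel"
      using borel_measurable_continuous_onI[OF c] by simp
    show "(\<lambda>z. indicator angle_box z * sin (fst z) / (4 * pi)) \<in> borel_measurable lborel"
      using integrable_angle_box_density by (rule borel_measurable_integrable)
  qed (use angle_box_density_nonneg in auto)
  also have "\<dots> = (LINT z:angle_box|lborel. f (spherical_coords z) * sin (fst z) / (4 * pi))"
    unfolding set_lebesgue_integral_def by (intro Bochner_Integration.integral_cong) auto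
  also have "\<dots> = integral angle_box (\<lambda>z. f (spherical_coords z) * sin (fst z) / (4 * pi))"
    unfolding angle_box_def set_integrable_def
    by (intro set_borel_integral_eq_integral, unfold set_integrable_def,
        intro borel_integrable_compact continuous_intros c) auto
  finally show ?thesis by (simp only: case_prod_unfold prod.collapse)
qed

lemma measure_vol_S2: "measure vol_S2 S2 = 1"
proof -
  interpret finite_measure vol_S2 using finite_borel_onD[OF finite_borel_on_vol_S2] by blast
  have "measure vol_S2 S2 = (\<integral>u. 1 \<partial>vol_S2)"
    using finite_borel_onD(3)[OF finite_borel_on_vol_S2] by simp
  also have "\<dots> = 1"
    using integral_angle_box_density by (subst integral_vol_S2) auto
  finally show ?thesis .
qed

section \<open>Invariance of means of zonal functions\<close>

text \<open>Swapping the order of integration puts the \<open>x\<close>-integral inside, where the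
  fundamental theorem gives a difference of equal boundary values.\<close>

lemma integral_cbox_partial_fst:
  fixes F F' :: "real \<Rightarrow> real \<Rightarrow> real"
  assumes "a \<le> b" "continuous_on (cbox (a, c) (b, d)) (\<lambda>(x, y). F' x y)"
    and "\<And>x y. ((\<lambda>x. F x y) has_real_derivative F' x y) (at x)"
    and "\<And>y. F a y = F b y"
  shows "integral (cbox (a, c) (b, d)) (\<lambda>(x, y). F' x y) = 0"
proof -
  have "integral (cbox a b) (\<lambda>x. F' x y) = F b y - F a y" for y
    using assms unfolding cbox_interval
    by (intro integral_unique fundamental_theorem_of_calculus)
       (auto simp flip: has_real_derivative_iff_has_vector_derivative
          intro: has_field_derivative_at_within)
  with integral_prod_continuous[OF assms(2)] integral_swap_continuous[OF assms(2)] assms(4)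
  show ?thesis by simp
qed

lemma integral_cbox_partial_snd:
  fixes F F' :: "real \<Rightarrow> real \<Rightarrow> real"
  assumes "c \<le> d" "continuous_on (cbox (a, c) (b, d)) (\<lambda>(x, y). F' x y)"
    and "\<And>x y. ((\<lambda>y. F x y) has_real_derivative F' x y) (at y)"
    and "\<And>x. F x c = F x d"
  shows "integral (cbox (a, c) (b, d)) (\<lambda>(x, y). F' x y) = 0"
proof -
  have "integral (cbox c d) (F' x) = F x d - F x c" for x
    using assms unfolding cbox_interval
    by (intro integral_unique fundamental_theorem_of_calculus)
       (auto simp flip: has_real_derivative_iff_has_vector_derivative
          intro: has_field_derivative_at_within)
  with integral_prod_continuous[OF assms(2)] assms(4)
  show ?thesis by simp
qed

text \<open>
  With \<open>u = spherical_coords (\<theta>, \<phi>)\<close>, the argument \<open>p \<theta> \<phi>\<close> is \<open>x \<bullet> u\<close> for the point \<open>x\<close> with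
  coordinates \<open>(t, \<alpha>)\<close>. Up to sign, moving \<open>t\<close> amounts to applying to \<open>u\<close> the rotation field
  \<open>cos (\<phi> - \<alpha>) \<partial>\<^sub>\<theta> - cot \<theta> sin (\<phi> - \<alpha>) \<partial>\<^sub>\<phi>\<close>, which is divergence free for
  \<open>sin \<theta> d\<theta> d\<phi>\<close>: the integrand below is \<open>\<partial>\<^sub>\<phi> G - \<partial>\<^sub>\<theta> F\<close>.
\<close>

lemma rotation_derivative_zero:
  fixes h h' :: "real \<Rightarrow> real" and t \<alpha> :: real
  assumes h: "\<And>x. (h has_real_derivative h' x) (at x)" and h': "continuous_on UNIV h'"
  defines "p \<equiv> \<lambda>\<theta> \<phi>. cos t * cos \<theta> + sin t * (sin \<theta> * cos (\<phi> - \<alpha>))"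
  shows "integral angle_box (\<lambda>(\<theta>, \<phi>).
    h' (p \<theta> \<phi>) * (cos t * (sin \<theta> * cos (\<phi> - \<alpha>)) - sin t * cos \<theta>) * sin \<theta>) = 0"
proof -
  have hc: "continuous_on UNIV h"
    using h by (intro DERIV_continuous_on) (auto intro: has_field_derivative_at_within)
  note [continuous_intros] = continuous_on_compose2[OF h'] continuous_on_compose2[OF hc]
  note [derivative_intros] = DERIV_chain2[OF h]
  \<comment> \<open>Up to the sign of \<open>G\<close>, these are \<open>h\<close> times the
    components of the rotation field, weighted by \<open>sin \<theta>\<close>. \<open>F\<close>
    vanishes at both poles through the factor \<open>sin \<theta>\<close>, and \<open>G\<close> is
    periodic in \<open>\<phi>\<close>, so neither derivative contributes to the integral.\<close>
  define F where "F = (\<lambda>\<theta> \<phi>. sin \<theta> * cos (\<phi> - \<alpha>) * h (p \<theta> \<phi>))"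
  define F' where "F' = (\<lambda>\<theta> \<phi>. cos \<theta> * cos (\<phi> - \<alpha>) * h (p \<theta> \<phi>) + sin \<theta> * cos (\<phi> - \<alpha>) *
    (h' (p \<theta> \<phi>) * (- cos t * sin \<theta> + sin t * (cos \<theta> * cos (\<phi> - \<alpha>)))))"
  define G where "G = (\<lambda>\<theta> \<phi>. cos \<theta> * sin (\<phi> - \<alpha>) * h (p \<theta> \<phi>))"
  define G' where "G' = (\<lambda>\<theta> \<phi>. cos \<theta> * cos (\<phi> - \<alpha>) * h (p \<theta> \<phi>) + cos \<theta> * sin (\<phi> - \<alpha>) *
    (h' (p \<theta> \<phi>) * (- sin t * (sin \<theta> * sin (\<phi> - \<alpha>)))))"
  have pc [continuous_intros]: "continuous_on A (\<lambda>z. p (fst z) (snd z))" for A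
    unfolding p_def by (intro continuous_intros)
  have F': "continuous_on A (\<lambda>(\<theta>, \<phi>). F' \<theta> \<phi>)" for A
    unfolding F'_def split_beta by (intro continuous_intros) auto
  have G': "continuous_on A (\<lambda>(\<theta>, \<phi>). G' \<theta> \<phi>)" for A
    unfolding G'_def split_beta by (intro continuous_intros) auto
  have "integral angle_box (\<lambda>(\<theta>, \<phi>). F' \<theta> \<phi>) = 0"
    unfolding angle_box_def
  proof (rule integral_cbox_partial_fst[where F=F])
    show "((\<lambda>\<theta>. F \<theta> \<phi>) has_real_derivative F' \<theta> \<phi>) (at \<theta>)" for \<theta> \<phi>
      unfolding F_def F'_def p_def
      by (auto intro!: derivative_eq_intros simp: algebra_simps)
  qed (auto simp: F_def F')
  moreover have "integral angle_box (\<lambda>(\<theta>, \<phi>). G' \<theta> \<phi>) = 0"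
    unfolding angle_box_def
  proof (rule integral_cbox_partial_snd[where F=G])
    show "((\<lambda>\<phi>. G \<theta> \<phi>) has_real_derivative G' \<theta> \<phi>) (at \<phi>)" for \<theta> \<phi>
      unfolding G_def G'_def p_def
      by (auto intro!: derivative_eq_intros simp: algebra_simps)
    show "G \<theta> 0 = G \<theta> (2 * pi)" for \<theta>
      by (simp add: G_def p_def sin_diff cos_diff)
  qed (auto simp: G')
  moreover have "(\<lambda>(\<theta>, \<phi>). F' \<theta> \<phi>) integrable_on angle_box" "(\<lambda>(\<theta>, \<phi>). G' \<theta> \<phi>) integrable_on angle_box"
    unfolding angle_box_def by (intro integrable_continuous F' G')+
  ultimately have "integral angle_box (\<lambda>z. (case z of (\<theta>, \<phi>) \<Rightarrow> G' \<theta> \<phi>) - (case z of (\<theta>, \<phi>) \<Rightarrow> F' \<theta> \<phi>)) = 0"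
    by (subst integral_diff) auto
  \<comment> \<open>The terms with undifferentiated \<open>h\<close> cancel: this is where the field
    is divergence free.\<close>
  moreover have "G' \<theta> \<phi> - F' \<theta> \<phi> =
    h' (p \<theta> \<phi>) * (cos t * (sin \<theta> * cos (\<phi> - \<alpha>)) - sin t * cos \<theta>) * sin \<theta>" for \<theta> \<phi>
  proof -
    have "G' \<theta> \<phi> - F' \<theta> \<phi> = h' (p \<theta> \<phi>) * sin \<theta> * (cos t * sin \<theta> * cos (\<phi> - \<alpha>)
        - sin t * cos \<theta> * ((sin (\<phi> - \<alpha>))\<^sup>2 + (cos (\<phi> - \<alpha>))\<^sup>2))"
      unfolding F'_def G'_def by algebra
    then show ?thesis by (simp only: sin_cos_squared_add) (simp add: mult.commute mult.left_commute)
  qed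
  ultimately show ?thesis by (simp add: case_prod_unfold)
qed

text \<open>Differentiating the left side in \<open>t\<close> under the integral gives the integral
  that \<open>rotation_derivative_zero\<close> shows to vanish. So the left side equals its value at
  \<open>t = 0\<close>, which is the right side.\<close>

lemma rotation_invariance_C1:
  fixes h h' :: "real \<Rightarrow> real" and t \<alpha> :: real
  assumes h: "\<And>x. (h has_real_derivative h' x) (at x)" and h': "continuous_on UNIV h'"
  shows "integral angle_box (\<lambda>(\<theta>, \<phi>). h (cos t * cos \<theta> + sin t * (sin \<theta> * cos (\<phi> - \<alpha>))) * sin \<theta>)
    = integral angle_box (\<lambda>(\<theta>, \<phi>). h (cos \<theta>) * sin \<theta>)"
proof -
  have hc: "continuous_on UNIV h"
    using h by (intro DERIV_continuous_on) (auto intro: has_field_derivative_at_within)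
  note [continuous_intros] = continuous_on_compose2[OF h'] continuous_on_compose2[OF hc]
  define I where "I = (\<lambda>t. integral angle_box (\<lambda>z.
    h (cos t * cos (fst z) + sin t * (sin (fst z) * cos (snd z - \<alpha>))) * sin (fst z)))"
  have "(I has_real_derivative 0) (at s)" for s
  proof -
    have "(I has_real_derivative integral angle_box (\<lambda>z.
      h' (cos s * cos (fst z) + sin s * (sin (fst z) * cos (snd z - \<alpha>))) *
        (cos s * (sin (fst z) * cos (snd z - \<alpha>)) - sin s * cos (fst z)) * sin (fst z))) (at s within UNIV)"
      unfolding I_def angle_box_def
    proof (rule leibniz_rule_field_derivative)
      show "((\<lambda>s. h (cos s * cos (fst z) + sin s * (sin (fst z) * cos (snd z - \<alpha>))) * sin (fst z))
        has_real_derivative h' (cos s * cos (fst z) + sin s * (sin (fst z) * cos (snd z - \<alpha>))) *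
        (cos s * (sin (fst z) * cos (snd z - \<alpha>)) - sin s * cos (fst z)) * sin (fst z)) (at s within UNIV)" for s z
        by (auto intro!: derivative_eq_intros DERIV_chain2[OF h])
      show "(\<lambda>z. h (cos s * cos (fst z) + sin s * (sin (fst z) * cos (snd z - \<alpha>))) * sin (fst z))
        integrable_on cbox (0, 0) (pi, 2 * pi)" for s
        by (intro integrable_continuous continuous_intros) auto
    qed (auto simp: split_beta intro!: continuous_intros)
    then show ?thesis
      using rotation_derivative_zero[OF h h', of s \<alpha>] by (simp add: case_prod_unfold)
  qed
  then have "I t = I 0"
    using DERIV_isconst_all by blast
  then show ?thesis by (simp add: I_def case_prod_unfold)
qed

lemma spherical_coords_surj:
  assumes "x \<in> S2"
  obtains \<phi> where "0 \<le> \<phi>" "\<phi> < 2 * pi" "x = spherical_coords (arccos (x $ 3), \<phi>)"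
proof -
  have x: "(x $ 1)\<^sup>2 + (x $ 2)\<^sup>2 + (x $ 3)\<^sup>2 = 1"
    using assms by (simp add: norm_eq_1_real3)
  have x3: "-1 \<le> x $ 3" "x $ 3 \<le> 1"
    using component_le_norm_cart[of x 3] assms by auto
  define r where "r = sin (arccos (x $ 3))"
  have r: "r\<^sup>2 = (x $ 1)\<^sup>2 + (x $ 2)\<^sup>2"
    using x x3 sin_cos_squared_add[of "arccos (x $ 3)"] by (simp add: r_def)
  obtain \<phi> where \<phi>: "0 \<le> \<phi>" "\<phi> < 2 * pi" "x $ 1 = r * cos \<phi>" "x $ 2 = r * sin \<phi>"
  \<comment> \<open>At the poles every longitude is admissible, and 0 is chosen.\<close>
  proof (cases "r = 0")
    case True
    with r have "x $ 1 = 0" "x $ 2 = 0" by (simp_all add: sum_power2_eq_zero_iff)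
    with True that[of 0] show ?thesis by simp
  next
    case False
    have "(x $ 1 / r)\<^sup>2 + (x $ 2 / r)\<^sup>2 = ((x $ 1)\<^sup>2 + (x $ 2)\<^sup>2) / r\<^sup>2"
      by (simp add: power_divide add_divide_distrib)
    also have "\<dots> = 1" using False by (simp flip: r)
    finally obtain \<phi> where "0 \<le> \<phi>" "\<phi> < 2 * pi" "x $ 1 / r = cos \<phi>" "x $ 2 / r = sin \<phi>"
      by (rule sincos_total_2pi)
    with False that[of \<phi>] show ?thesis by (simp add: field_simps)
  qed
  moreover have "x = spherical_coords (arccos (x $ 3), \<phi>)"
    using \<phi> x3 by (simp add: vec_eq_iff forall_3 spherical_coords_nth r_def)
  ultimately show ?thesis using that by blast
qed

lemma inner_S2: "x \<in> S2 \<Longrightarrow> y \<in> S2 \<Longrightarrow> x \<bullet> y \<in> {-1..1}" for x y :: "real^3"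
  using Cauchy_Schwarz_ineq2[of x y] by auto

lemma component_S2: "x \<in> S2 \<Longrightarrow> x $ i \<in> {-1..1}" for x :: "real^3"
  using component_le_norm_cart[of x i] by auto

lemma continuous_on_zonal:
  fixes h :: "real \<Rightarrow> real"
  assumes "continuous_on {-1..1} h"
  shows "continuous_on (S2 \<times> S2) (\<lambda>(x :: real^3, u). h (x \<bullet> u))"
  unfolding split_beta
  by (rule continuous_on_compose2[OF assms]) (use inner_S2 in \<open>auto intro!: continuous_intros\<close>)

lemma continuous_on_height:
  fixes h :: "real \<Rightarrow> real"
  assumes "continuous_on {-1..1} h"
  shows "continuous_on S2 (\<lambda>u :: real^3. h (u $ 3))"
  by (rule continuous_on_compose2[OF assms])
     (use component_S2 in \<open>auto simp del: atLeastAtMost_iff intro!: continuous_intros\<close>)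

text \<open>By the spherical law of cosines, \<open>x \<bullet> u\<close> has the form treated in
  \<open>rotation_invariance_C1\<close>, with \<open>t\<close> and \<open>\<alpha>\<close> the
  angles of \<open>x\<close>; \<open>u $ 3\<close> is the inner product of \<open>u\<close> with the
  north pole.\<close>

lemma integral_zonal_C1:
  fixes h h' :: "real \<Rightarrow> real"
  assumes h: "\<And>x. (h has_real_derivative h' x) (at x)" and h': "continuous_on UNIV h'"
    and x: "x \<in> S2"
  shows "(\<integral>u. h (x \<bullet> u) \<partial>vol_S2) = (\<integral>u. h (u $ 3) \<partial>vol_S2)"
proof -
  have hc: "continuous_on A h" for A
    using h by (intro DERIV_continuous_on) (auto intro: has_field_derivative_at_within)
  obtain \<alpha> where \<alpha>: "x = spherical_coords (arccos (x $ 3), \<alpha>)"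
    using spherical_coords_surj[OF x] by blast
  define t where "t = arccos (x $ 3)"
  have "x \<bullet> spherical_coords z = cos t * cos (fst z) + sin t * (sin (fst z) * cos (snd z - \<alpha>))" for z
    by (subst \<alpha>, unfold t_def[symmetric])
       (simp add: inner_real3 spherical_coords_nth cos_diff algebra_simps)
  then have "(\<integral>u. h (x \<bullet> u) \<partial>vol_S2) = integral angle_box
      (\<lambda>z. h (cos t * cos (fst z) + sin t * (sin (fst z) * cos (snd z - \<alpha>))) * sin (fst z)) / (4 * pi)"
    using continuous_on_slices(1)[OF continuous_on_zonal[OF hc] x]
    by (simp add: integral_vol_S2 case_prod_unfold)
  also have "\<dots> = integral angle_box (\<lambda>z. h (cos (fst z)) * sin (fst z)) / (4 * pi)"
    using rotation_invariance_C1[OF h h', of t \<alpha>] by (simp add: case_prod_unfold)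
  also have "\<dots> = (\<integral>u. h (u $ 3) \<partial>vol_S2)"
    using continuous_on_height[OF hc]
    by (simp add: integral_vol_S2 case_prod_unfold spherical_coords_nth)
  finally show ?thesis .
qed

text \<open>Polynomials are dense in the continuous functions on \<open>[-1, 1]\<close> and satisfy
  the claim by \<open>integral_zonal_C1\<close>. As \<open>vol_S2\<close> has mass one, replacing
  \<open>h\<close> by a polynomial within \<open>e / 2\<close> changes each side by at most
  \<open>e / 2\<close>.\<close>

lemma integral_zonal:
  fixes h :: "real \<Rightarrow> real"
  assumes h: "continuous_on {-1..1} h" and x: "x \<in> S2"
  shows "(\<integral>u. h (x \<bullet> u) \<partial>vol_S2) = (\<integral>u. h (u $ 3) \<partial>vol_S2)"
proof -
  note v = finite_borel_onD[OF finite_borel_on_vol_S2]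
  have *: "\<bar>(\<integral>u. h (x \<bullet> u) \<partial>vol_S2) - (\<integral>u. h (u $ 3) \<partial>vol_S2)\<bar> \<le> e" if "e > 0" for e
  proof -
    obtain g where g: "real_polynomial_function g" "\<And>y. y \<in> {-1..1} \<Longrightarrow> \<bar>h y - g y\<bar> < e / 2"
      using Stone_Weierstrass_real_polynomial_function[of "{-1..1}" h "e / 2"] h \<open>e > 0\<close> by auto
    obtain g' where g': "real_polynomial_function g'" "\<And>x. (g has_real_derivative g' x) (at x)"
      using has_real_derivative_polynomial_function[OF g(1)] by blast
    have gc: "continuous_on A g" for A
      using g' by (intro DERIV_continuous_on) (auto intro: has_field_derivative_at_within)
    have g'c: "continuous_on UNIV g'"
      using g'(1) by (intro continuous_on_polymonial_function) (simp add: real_polynomial_function_eq)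
    have "\<bar>(\<integral>u. h (x \<bullet> u) \<partial>vol_S2) - (\<integral>u. g (x \<bullet> u) \<partial>vol_S2)\<bar> \<le> e / 2 * measure vol_S2 (space vol_S2)"
    proof (rule abs_integral_diff_le)
      show "\<bar>h (x \<bullet> u) - g (x \<bullet> u)\<bar> \<le> e / 2" if "u \<in> space vol_S2" for u
        using g(2) inner_S2[OF x, of u] that v by (simp add: less_imp_le)
    qed (use v continuous_on_slices(1)[OF continuous_on_zonal x] h gc in
          \<open>auto intro!: integrable_continuous_compact[OF _ finite_borel_on_vol_S2]\<close>)
    moreover have "\<bar>(\<integral>u. h (u $ 3) \<partial>vol_S2) - (\<integral>u. g (u $ 3) \<partial>vol_S2)\<bar> \<le> e / 2 * measure vol_S2 (space vol_S2)"
    proof (rule abs_integral_diff_le)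
      show "\<bar>h (u $ 3) - g (u $ 3)\<bar> \<le> e / 2" if "u \<in> space vol_S2" for u
        using g(2) component_S2[of u 3] that v by (simp add: less_imp_le)
    qed (use v continuous_on_height h gc in
          \<open>auto intro!: integrable_continuous_compact[OF _ finite_borel_on_vol_S2]\<close>)
    moreover have "(\<integral>u. g (x \<bullet> u) \<partial>vol_S2) = (\<integral>u. g (u $ 3) \<partial>vol_S2)"
      by (rule integral_zonal_C1[OF g'(2) g'c x])
    ultimately show ?thesis unfolding v measure_vol_S2 by linarith
  qed
  have "\<bar>(\<integral>u. h (x \<bullet> u) \<partial>vol_S2) - (\<integral>u. h (u $ 3) \<partial>vol_S2)\<bar> \<le> 0"
    by (rule field_le_epsilon) (simp only: add_0 *)
  then show ?thesis by simp
qed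

text \<open>A continuous nonnegative integrand with integral zero would vanish on the whole box. It
  is positive at height \<open>1 - d / 2\<close>, which lies inside the cap but off the pole, where
  the factor \<open>sin\<close> would be zero.\<close>

lemma integral_cap_bump_pos:
  assumes "0 < d" "d < 1"
  shows "(\<integral>u. max 0 (u $ 3 - (1 - d)) \<partial>vol_S2) > 0"
proof -
  let ?f = "\<lambda>z::real\<times>real. max 0 (cos (fst z) - (1 - d)) * sin (fst z) / (4 * pi)"
  have fc: "continuous_on (cbox (0, 0) (pi, 2 * pi)) ?f"
    by (intro continuous_intros) auto
  have nonneg: "?f z \<ge> 0" if "z \<in> cbox (0, 0) (pi, 2 * pi)" for z
    using that by (intro divide_nonneg_pos mult_nonneg_nonneg sin_ge_zero) (auto simp: cbox_Pair_eq)
  have "(\<integral>u. max 0 (u $ 3 - (1 - d)) \<partial>vol_S2) = integral angle_box ?f"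
    by (subst integral_vol_S2)
       (auto intro!: continuous_intros simp: case_prod_unfold spherical_coords_nth)
  moreover have "integral angle_box ?f \<noteq> 0"
  proof
    let ?t = "arccos (1 - d / 2)"
    assume "integral angle_box ?f = 0"
    then have "\<forall>z\<in>cbox (0, 0) (pi, 2 * pi). ?f z = 0"
      unfolding angle_box_def
      using integral_cbox_eq_0_iff[OF fc _ nonneg] by (simp add: box_ne_empty Basis_prod_def)
    moreover have "(?t, 0) \<in> cbox (0, 0) (pi, 2 * pi)"
      using assms arccos_bounded[of "1 - d / 2"] by (simp add: cbox_Pair_eq)
    ultimately have "?f (?t, 0) = 0" by blast
    moreover have "cos ?t = 1 - d / 2" using assms by (intro cos_arccos) auto
    moreover have "sin ?t > 0"
      using assms arccos_lt_bounded[of "1 - d / 2"] by (intro sin_gt_zero) auto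
    ultimately show False using assms by simp
  qed
  moreover have "integral angle_box ?f \<ge> 0"
    unfolding angle_box_def using nonneg fc by (intro integral_nonneg integrable_continuous)
  ultimately show ?thesis by linarith
qed

section \<open>Latitude means and rotations about the vertical axis\<close>

lemma integral_periodic_shift:
  fixes f :: "real \<Rightarrow> real"
  assumes f: "continuous_on UNIV f" and per: "\<And>x. f (x + 2 * pi) = f x"
    and b: "0 \<le> b" "b \<le> 2 * pi"
  shows "integral {0..2 * pi} (\<lambda>x. f (b + x)) = integral {0..2 * pi} f"
proof -
  have i: "f integrable_on {c..d}" for c d
    using f by (intro integrable_continuous_real) (auto intro: continuous_on_subset)
  have "integral {0..2 * pi} (\<lambda>x. f (b + x)) = integral {b..2 * pi + b} f"
    using integral_shift_Icc_real[of 0 "2 * pi" f b] by (simp add: o_def)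
  also have "\<dots> = integral {b..2 * pi} f + integral {2 * pi..2 * pi + b} f"
    using b i by (intro Henstock_Kurzweil_Integration.integral_combine[symmetric]) auto
  also have "integral {2 * pi..2 * pi + b} f = integral {0..b} f"
    using integral_shift_Icc_real[of 0 b f "2 * pi"] per by (simp add: o_def add.commute)
  also have "integral {b..2 * pi} f + integral {0..b} f = integral {0..2 * pi} f"
    using b i Henstock_Kurzweil_Integration.integral_combine[of 0 b "2 * pi" f] by simp
  finally show ?thesis .
qed

text \<open>The argument is the height \<open>t\<close>, not the polar angle, so that
  \<open>latitude_mean k (x \<bullet> u)\<close> is at once the analogous zonal function about any
  pole \<open>u\<close>.\<close>

definition latitude_mean :: "(real^3 \<Rightarrow> real) \<Rightarrow> real \<Rightarrow> real"
  where "latitude_mean k t = integral {0..2 * pi} (\<lambda>\<phi>. k (spherical_coords (arccos t, \<phi>))) / (2 * pi)"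

lemma continuous_on_comp_spherical_coords:
  fixes k :: "real^3 \<Rightarrow> real"
  assumes "continuous_on S2 k" "continuous_on A f"
  shows "continuous_on A (\<lambda>z. k (spherical_coords (f z)))"
  by (rule continuous_on_compose2[OF assms(1)]) (auto intro!: continuous_intros assms)

lemma continuous_on_latitude_mean:
  assumes "continuous_on S2 k"
  shows "continuous_on {-1..1} (latitude_mean k)"
proof -
  have "continuous_on {-1..1} (\<lambda>t. integral (cbox 0 (2 * pi)) (\<lambda>\<phi>. k (spherical_coords (arccos t, \<phi>))))"
    by (rule integral_continuous_on_param)
       (auto simp: split_beta intro!: continuous_on_comp_spherical_coords[OF assms] continuous_intros)
  then show ?thesis
    unfolding latitude_mean_def by (intro continuous_intros) auto
qed

text \<open>The density does not depend on the longitude, so by Fubini \<open>k\<close> may be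
  replaced by its mean over each circle of latitude.\<close>

lemma integral_latitude_mean:
  assumes k: "continuous_on S2 k"
  shows "(\<integral>u. latitude_mean k (u $ 3) \<partial>vol_S2) = (\<integral>u. k u \<partial>vol_S2)"
proof -
  have "(\<integral>u. k u \<partial>vol_S2) = integral (cbox (0, 0) (pi, 2 * pi)) (\<lambda>(\<theta>, \<phi>). k (spherical_coords (\<theta>, \<phi>)) * sin \<theta> / (4 * pi))"
    using integral_vol_S2[OF k] by (simp add: angle_box_def)
  also have "\<dots> = integral (cbox 0 pi) (\<lambda>\<theta>. integral (cbox 0 (2 * pi)) (\<lambda>\<phi>. k (spherical_coords (\<theta>, \<phi>)) * sin \<theta> / (4 * pi)))"
    by (subst integral_prod_continuous)
       (auto simp: case_prod_unfold intro!: continuous_intros continuous_on_comp_spherical_coords[OF k])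
  also have "\<dots> = integral (cbox 0 pi) (\<lambda>\<theta>. integral (cbox 0 (2 * pi)) (\<lambda>\<phi>. latitude_mean k (cos \<theta>) * sin \<theta> / (4 * pi)))"
    by (rule Henstock_Kurzweil_Integration.integral_cong) (simp add: latitude_mean_def arccos_cos)
  also have "\<dots> = integral (cbox (0, 0) (pi, 2 * pi)) (\<lambda>(\<theta>, \<phi>). latitude_mean k (cos \<theta>) * sin \<theta> / (4 * pi))"
    by (subst integral_prod_continuous)
       (auto simp: case_prod_unfold intro!: continuous_intros continuous_on_compose2[OF continuous_on_latitude_mean[OF k]])
  also have "\<dots> = (\<integral>u. latitude_mean k (u $ 3) \<partial>vol_S2)"
    using integral_vol_S2[OF continuous_on_height[OF continuous_on_latitude_mean[OF k]]]
    by (simp add: angle_box_def case_prod_unfold spherical_coords_nth)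
  finally show ?thesis by simp
qed

definition rot_z :: "real \<Rightarrow> real^3 \<Rightarrow> real^3"
  where "rot_z \<alpha> x = vector [cos \<alpha> * x $ 1 - sin \<alpha> * x $ 2, sin \<alpha> * x $ 1 + cos \<alpha> * x $ 2, x $ 3]"

lemma rot_z_nth:
  "rot_z \<alpha> x $ 1 = cos \<alpha> * x $ 1 - sin \<alpha> * x $ 2"
  "rot_z \<alpha> x $ 2 = sin \<alpha> * x $ 1 + cos \<alpha> * x $ 2"
  "rot_z \<alpha> x $ 3 = x $ 3"
  by (simp_all add: rot_z_def vector_3)

lemma orthogonal_transformation_rot_z: "orthogonal_transformation (rot_z \<alpha>)"
proof -
  have "rot_z \<alpha> x \<bullet> rot_z \<alpha> y = ((cos \<alpha>)\<^sup>2 + (sin \<alpha>)\<^sup>2) * (x $ 1 * y $ 1 + x $ 2 * y $ 2) + x $ 3 * y $ 3" for x y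
    unfolding inner_real3 rot_z_nth by algebra
  then have "rot_z \<alpha> x \<bullet> rot_z \<alpha> y = x \<bullet> y" for x y
    by (simp only: sin_cos_squared_add2 inner_real3 mult_1)
  moreover have "linear (rot_z \<alpha>)"
    by (rule linearI) (simp_all add: vec_eq_iff forall_3 rot_z_nth algebra_simps)
  ultimately show ?thesis by (simp add: orthogonal_transformation_def)
qed

lemma rot_z_spherical_coords: "rot_z \<alpha> (spherical_coords (\<theta>, \<phi>)) = spherical_coords (\<theta>, \<phi> + \<alpha>)"
  by (simp add: vec_eq_iff forall_3 rot_z_nth spherical_coords_nth cos_add sin_add algebra_simps)

lemma continuous_on_rot_z:
  fixes f :: "'a::t2_space \<Rightarrow> real"
  assumes "continuous_on A f" "continuous_on A g"
  shows "continuous_on A (\<lambda>z. rot_z (f z) (g z))"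
proof -
  have "continuous_on A (\<lambda>z. rot_z (f z) (g z) $ i)" for i
    using exhaust_3[of i]
    by (elim disjE; simp only: rot_z_nth;
        intro continuous_on_add continuous_on_diff continuous_on_mult continuous_on_sin continuous_on_cos
          continuous_on_component assms)
  then show ?thesis
    by (subst continuous_on_componentwise) (auto simp: Basis_vec_def inner_axis)
qed

text \<open>The rotations about the vertical axis move \<open>y\<close> once around its circle of
  latitude, starting from its own longitude; periodicity removes that offset.\<close>

lemma integral_rot_z:
  assumes k: "continuous_on S2 k" and y: "y \<in> S2"
  shows "integral {0..2 * pi} (\<lambda>\<alpha>. k (rot_z \<alpha> y)) = 2 * pi * latitude_mean k (y $ 3)"
proof -
  obtain \<phi> where \<phi>: "0 \<le> \<phi>" "\<phi> < 2 * pi" "y = spherical_coords (arccos (y $ 3), \<phi>)"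
    using spherical_coords_surj[OF y] by blast
  define f where "f = (\<lambda>x. k (spherical_coords (arccos (y $ 3), x)))"
  have "k (rot_z \<alpha> y) = f (\<phi> + \<alpha>)" for \<alpha>
    by (subst \<phi>(3)) (simp add: rot_z_spherical_coords f_def)
  then have "integral {0..2 * pi} (\<lambda>\<alpha>. k (rot_z \<alpha> y)) = integral {0..2 * pi} (\<lambda>\<alpha>. f (\<phi> + \<alpha>))"
    by simp
  also have "\<dots> = integral {0..2 * pi} f"
  proof (rule integral_periodic_shift)
    show "continuous_on UNIV f"
      unfolding f_def by (intro continuous_on_comp_spherical_coords[OF k] continuous_intros)
    show "f (x + 2 * pi) = f x" for x
      by (simp add: f_def spherical_coords_def)
  qed (use \<phi> in auto)
  finally show ?thesis by (simp add: f_def latitude_mean_def)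
qed

text \<open>Lets the average over angles be exchanged with the integral over \<open>\<rho>\<close>
  by the same Fubini lemma as the average over poles.\<close>

lemma finite_borel_on_lborel_interval: "finite_borel_on {a..b} (restrict_space lborel {a..b :: real})"
  using emeasure_lborel_cbox_finite[of a b]
  by (auto simp: finite_borel_on_def sets_restrict_space emeasure_restrict_space space_restrict_space
      less_top intro!: finite_measureI)

lemma integral_lborel_interval:
  fixes f :: "real \<Rightarrow> real"
  assumes "continuous_on {a..b} f"
  shows "(\<integral>x. f x \<partial>restrict_space lborel {a..b}) = integral {a..b} f"
proof -
  have "(\<integral>x. f x \<partial>restrict_space lborel {a..b}) = (LINT x:{a..b}|lborel. f x)"
    by (simp add: integral_restrict_space set_lebesgue_integral_def)
  also have "\<dots> = integral {a..b} f"
    using borel_integrable_compact[OF _ assms]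
    by (intro set_borel_integral_eq_integral) (simp add: set_integrable_def)
  finally show ?thesis .
qed

section \<open>Averaging over rotations\<close>

lemma exists_rotation_integral_ge:
  fixes k :: "real^3 \<Rightarrow> real"
  assumes \<rho>: "finite_borel_on S2 \<rho>" "measure \<rho> S2 = 1" and k: "continuous_on S2 k"
  obtains g where "orthogonal_transformation g"
    "(\<integral>u. k u \<partial>vol_S2) \<le> (\<integral>x. k (g x) \<partial>\<rho>)"
proof -
  define h where "h = latitude_mean k"
  define m where "m = (\<integral>u. k u \<partial>vol_S2)"
  interpret finite_measure \<rho> using finite_borel_onD[OF \<rho>(1)] by blast
  have c2: "compact S2" "S2 \<noteq> {}" by (auto simp: sphere_eq_empty)
  have h: "continuous_on {-1..1} h"
    unfolding h_def by (rule continuous_on_latitude_mean[OF k])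
  have hm: "(\<integral>u. h (x \<bullet> u) \<partial>vol_S2) = m" if "x \<in> S2" for x
    using integral_zonal[OF h that] integral_latitude_mean[OF k] by (simp add: h_def m_def)
  txt \<open>The mean over all poles \<open>u\<close> equals \<open>m\<close>, so some pole does at least as well; then likewise
    for the rotation angle about it.\<close>
  have "(\<integral>x. \<integral>u. h (x \<bullet> u) \<partial>vol_S2 \<partial>\<rho>) = (\<integral>x. m \<partial>\<rho>)"
    using finite_borel_onD(3)[OF \<rho>(1)] hm by (intro Bochner_Integration.integral_cong) auto
  then have "m = (\<integral>u. \<integral>x. h (x \<bullet> u) \<partial>\<rho> \<partial>vol_S2)"
    using integral_swap_continuous_measure[OF c2(1) c2(1) \<rho>(1) finite_borel_on_vol_S2 continuous_on_zonal[OF h]]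
      \<rho>(2) finite_borel_onD(3)[OF \<rho>(1)] by simp
  moreover have "continuous_on S2 (\<lambda>u. \<integral>x. h (x \<bullet> u) \<partial>\<rho>)"
    by (rule continuous_on_integral_param[OF c2(1) c2(1) \<rho>(1)
          continuous_on_swap_args[OF continuous_on_zonal[OF h]]])
  ultimately obtain u where u: "u \<in> S2" "m \<le> (\<integral>x. h (x \<bullet> u) \<partial>\<rho>)"
    using integral_le_max_compact[OF c2 finite_borel_on_vol_S2, of "\<lambda>u. \<integral>x. h (x \<bullet> u) \<partial>\<rho>"]
    by (simp only: measure_vol_S2 mult_1_right) metis
  have "norm u = norm (axis 3 1 :: real^3)" using u by simp
  \<comment> \<open>\<open>B\<close> may be a reflection as well as a rotation. It keeps inner
    products, and the Lagrangian depends on nothing else.\<close>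
  then obtain B :: "real^3 \<Rightarrow> real^3" where B: "orthogonal_transformation B" "B u = axis 3 1"
    by (rule orthogonal_transformation_exists)
  have BS: "B x \<in> S2" if "x \<in> S2" for x
    using that B by (simp add: orthogonal_transformation_norm)
  \<comment> \<open>Taking \<open>u\<close> to the north pole makes \<open>x \<bullet> u\<close> the
    height of \<open>B x\<close>, so that \<open>rot_z \<alpha>\<close> applied after
    \<open>B\<close> realizes the circle mean hidden in \<open>h (x \<bullet> u)\<close>.\<close>
  have B3: "B x $ 3 = x \<bullet> u" for x
    using B(1) unfolding orthogonal_transformation_def cart_eq_inner_axis B(2)[symmetric] by blast
  have Bc: "continuous_on A B" for A
    using B by (intro linear_continuous_on) (simp add: orthogonal_transformation_def linear_conv_bounded_linear)
  let ?N = "restrict_space lborel {0..2 * pi}"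
  have N: "finite_borel_on {0..2 * pi} ?N" by (rule finite_borel_on_lborel_interval)
  have kc: "continuous_on ({0..2 * pi} \<times> S2) (\<lambda>(\<alpha>, x). k (rot_z \<alpha> (B x)))"
    unfolding case_prod_unfold
  proof (rule continuous_on_compose2[OF k])
    show "continuous_on ({0..2 * pi} \<times> S2) (\<lambda>z. rot_z (fst z) (B (snd z)))"
      by (intro continuous_on_rot_z continuous_on_compose2[OF Bc[of UNIV]] continuous_intros) auto
    show "(\<lambda>z. rot_z (fst z) (B (snd z))) ` ({0..2 * pi} \<times> S2) \<subseteq> S2"
      using BS by (auto simp: orthogonal_transformation_norm[OF orthogonal_transformation_rot_z])
  qed
  have "2 * pi * m \<le> 2 * pi * (\<integral>x. h (x \<bullet> u) \<partial>\<rho>)"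
    using u(2) by simp
  also have "\<dots> = (\<integral>x. 2 * pi * h (x \<bullet> u) \<partial>\<rho>)" by simp
  also have "\<dots> = (\<integral>x. \<integral>\<alpha>. k (rot_z \<alpha> (B x)) \<partial>?N \<partial>\<rho>)"
  proof (rule Bochner_Integration.integral_cong)
    fix x assume "x \<in> space \<rho>"
    then have x: "x \<in> S2" using finite_borel_onD(3)[OF \<rho>(1)] by simp
    show "2 * pi * h (x \<bullet> u) = (\<integral>\<alpha>. k (rot_z \<alpha> (B x)) \<partial>?N)"
      using integral_rot_z[OF k BS[OF x]] continuous_on_slices(2)[OF kc x]
      by (simp add: integral_lborel_interval h_def B3)
  qed simp
  also have "\<dots> = (\<integral>\<alpha>. \<integral>x. k (rot_z \<alpha> (B x)) \<partial>\<rho> \<partial>?N)"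
    by (rule integral_swap_continuous_measure[OF compact_Icc c2(1) N \<rho>(1) kc, symmetric])
  finally have le: "2 * pi * m \<le> (\<integral>\<alpha>. \<integral>x. k (rot_z \<alpha> (B x)) \<partial>\<rho> \<partial>?N)" .
  obtain \<alpha> where "(\<integral>\<alpha>. \<integral>x. k (rot_z \<alpha> (B x)) \<partial>\<rho> \<partial>?N) \<le> (\<integral>x. k (rot_z \<alpha> (B x)) \<partial>\<rho>) * measure ?N {0..2 * pi}"
  proof (rule integral_le_max_compact[OF compact_Icc _ N])
    show "continuous_on {0..2 * pi} (\<lambda>\<alpha>. \<integral>x. k (rot_z \<alpha> (B x)) \<partial>\<rho>)"
      by (rule continuous_on_integral_param[OF compact_Icc c2(1) \<rho>(1) kc])
  qed auto
  note order_trans[OF le this]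
  moreover have "measure ?N {0..2 * pi} = 2 * pi"
    by (simp add: measure_restrict_space)
  ultimately have "2 * pi * m \<le> (\<integral>x. k (rot_z \<alpha> (B x)) \<partial>\<rho>) * (2 * pi)"
    by (simp only:)
  then have "m \<le> (\<integral>x. k ((rot_z \<alpha> \<circ> B) x) \<partial>\<rho>)" by simp
  moreover have "orthogonal_transformation (rot_z \<alpha> \<circ> B)"
    by (intro orthogonal_transformation_compose orthogonal_transformation_rot_z B)
  ultimately show ?thesis using that by (simp add: m_def)
qed

section \<open>Positivity for measures\<close>

text \<open>A tent supported on the cap of depth \<open>d\<close>. It is normalized at the north
  pole, which by \<open>integral_zonal\<close> normalizes it about every pole. As \<open>d\<close>
  tends to 0 it is an approximate identity.\<close>

definition cap_bump :: "real \<Rightarrow> real \<Rightarrow> real"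
  where "cap_bump d t = max 0 (t - (1 - d)) / (\<integral>u. max 0 (u $ 3 - (1 - d)) \<partial>vol_S2)"

lemma continuous_on_cap_bump: "continuous_on A (cap_bump d)"
  unfolding cap_bump_def divide_inverse by (intro continuous_intros)

lemma integral_cap_bump:
  assumes "0 < d" "d < 1" "x \<in> S2"
  shows "(\<integral>u. cap_bump d (x \<bullet> u) \<partial>vol_S2) = 1"
  unfolding integral_zonal[OF continuous_on_cap_bump assms(3)]
  using integral_cap_bump_pos[OF assms(1,2)] by (simp add: cap_bump_def)

lemma cap_bump_nonneg: "0 < d \<Longrightarrow> d < 1 \<Longrightarrow> 0 \<le> cap_bump d t"
  using integral_cap_bump_pos[of d] by (simp add: cap_bump_def)

lemma cap_bump_eq_0: "t \<le> 1 - d \<Longrightarrow> cap_bump d t = 0"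
  by (simp add: cap_bump_def)

text \<open>The spherical convolution of \<open>\<sigma>\<close> with the bump, a density with
  respect to \<open>vol_S2\<close>.\<close>

definition mollified_density :: "real \<Rightarrow> (real^3) measure \<Rightarrow> real^3 \<Rightarrow> real"
  where "mollified_density d \<sigma> y = (\<integral>x. cap_bump d (x \<bullet> y) \<partial>\<sigma>)"

lemma compact_S2: "compact S2"
  by simp

lemma continuous_on_mollified_density:
  assumes "finite_borel_on S2 \<sigma>"
  shows "continuous_on S2 (mollified_density d \<sigma>)"
  unfolding mollified_density_def
  by (rule continuous_on_integral_param[OF compact_S2 compact_S2 assms
        continuous_on_swap_args[OF continuous_on_zonal[OF continuous_on_cap_bump]]])

lemma mollified_density_nonneg:
  "0 < d \<Longrightarrow> d < 1 \<Longrightarrow> 0 \<le> mollified_density d \<sigma> y"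
  unfolding mollified_density_def by (intro Bochner_Integration.integral_nonneg cap_bump_nonneg)

lemma integrable_vol_S2:
  fixes f :: "real^3 \<Rightarrow> real"
  assumes "continuous_on S2 f"
  shows "integrable vol_S2 f"
  by (rule integrable_continuous_compact[OF compact_S2 finite_borel_on_vol_S2 assms])

text \<open>Fubini moves the smoothing from \<open>\<sigma>\<close> to \<open>k\<close>: the first
  integral is the \<open>\<sigma>\<close>-mean of the averages of \<open>k\<close> over caps about
  \<open>x\<close>. Each average is within \<open>e\<close> of \<open>k x\<close>, since the weight
  is nonnegative, has integral one and lives where \<open>k\<close> differs from \<open>k x\<close>
  by at most \<open>e\<close>.\<close>

lemma integral_mollified_density:
  fixes k :: "real^3 \<Rightarrow> real"
  assumes \<sigma>: "finite_borel_on S2 \<sigma>" "measure \<sigma> S2 = 1" and d: "0 < d" "d < 1"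
    and k: "continuous_on S2 k"
    and osc: "\<And>x y. x \<in> S2 \<Longrightarrow> y \<in> S2 \<Longrightarrow> x \<bullet> y > 1 - d \<Longrightarrow> \<bar>k x - k y\<bar> \<le> e"
  shows "\<bar>(\<integral>y. k y * mollified_density d \<sigma> y \<partial>vol_S2) - (\<integral>x. k x \<partial>\<sigma>)\<bar> \<le> e"
proof -
  note s = finite_borel_onD[OF \<sigma>(1)] and v = finite_borel_onD[OF finite_borel_on_vol_S2]
  have ky: "continuous_on (S2 \<times> S2) (\<lambda>(x :: real^3, y). k y)"
    unfolding case_prod_unfold
    by (rule continuous_on_compose2[OF k]) (auto intro: continuous_on_snd)
  have c: "continuous_on (S2 \<times> S2) (\<lambda>(x, y). k y * cap_bump d (x \<bullet> y))"
    using continuous_on_mult[OF ky continuous_on_zonal[OF continuous_on_cap_bump, of d]]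
    by (simp add: case_prod_unfold)
  have "(\<integral>y. k y * mollified_density d \<sigma> y \<partial>vol_S2) = (\<integral>y. \<integral>x. k y * cap_bump d (x \<bullet> y) \<partial>\<sigma> \<partial>vol_S2)"
    by (simp add: mollified_density_def)
  also have "\<dots> = (\<integral>x. \<integral>y. k y * cap_bump d (x \<bullet> y) \<partial>vol_S2 \<partial>\<sigma>)"
    by (rule integral_swap_continuous_measure[OF compact_S2 compact_S2 \<sigma>(1) finite_borel_on_vol_S2 c, symmetric])
  finally have eq: "(\<integral>y. k y * mollified_density d \<sigma> y \<partial>vol_S2) = \<dots>" .
  have "\<bar>(\<integral>y. k y * mollified_density d \<sigma> y \<partial>vol_S2) - (\<integral>x. k x \<partial>\<sigma>)\<bar> \<le> e * measure \<sigma> (space \<sigma>)"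
    unfolding eq
  proof (rule abs_integral_diff_le[OF s(1)])
    show "integrable \<sigma> (\<lambda>x. \<integral>y. k y * cap_bump d (x \<bullet> y) \<partial>vol_S2)"
      by (rule integrable_continuous_compact[OF compact_S2 \<sigma>(1)
            continuous_on_integral_param[OF compact_S2 compact_S2 finite_borel_on_vol_S2 c]])
    show "integrable \<sigma> k"
      by (rule integrable_continuous_compact[OF compact_S2 \<sigma>(1) k])
    fix x assume "x \<in> space \<sigma>"
    then have x: "x \<in> S2" using s(3) by simp
    have w: "integrable vol_S2 (\<lambda>y. cap_bump d (x \<bullet> y))"
      by (rule integrable_vol_S2[OF continuous_on_slices(1)[OF continuous_on_zonal[OF continuous_on_cap_bump] x]])
    have kw: "integrable vol_S2 (\<lambda>y. k y * cap_bump d (x \<bullet> y))"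
      by (rule integrable_vol_S2[OF continuous_on_slices(1)[OF c x]])
    have le: "\<bar>(k y - k x) * cap_bump d (x \<bullet> y)\<bar> \<le> e * cap_bump d (x \<bullet> y)" if "y \<in> S2" for y
    proof (cases "x \<bullet> y > 1 - d")
      case True
      then show ?thesis
        using osc[OF x that] cap_bump_nonneg[OF d]
        by (simp add: abs_mult abs_minus_commute mult_right_mono)
    next
      case False
      then show ?thesis by (simp add: cap_bump_eq_0)
    qed
    have diff: "(\<integral>y. k y * cap_bump d (x \<bullet> y) \<partial>vol_S2) - k x = (\<integral>y. (k y - k x) * cap_bump d (x \<bullet> y) \<partial>vol_S2)"
      using w kw integral_cap_bump[OF d x] by (simp add: left_diff_distrib)
    have int: "integrable vol_S2 (\<lambda>y. (k y - k x) * cap_bump d (x \<bullet> y))"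
      using w kw by (simp add: left_diff_distrib)
    have "\<bar>(\<integral>y. k y * cap_bump d (x \<bullet> y) \<partial>vol_S2) - k x\<bar> \<le> (\<integral>y. \<bar>(k y - k x) * cap_bump d (x \<bullet> y)\<bar> \<partial>vol_S2)"
      unfolding diff by (rule integral_abs_bound)
    also have "\<dots> \<le> (\<integral>y. e * cap_bump d (x \<bullet> y) \<partial>vol_S2)"
      using w int le v(3) by (intro integral_mono) auto
    also have "\<dots> = e" using integral_cap_bump[OF d x] by simp
    finally show "\<bar>(\<integral>y. k y * cap_bump d (x \<bullet> y) \<partial>vol_S2) - k x\<bar> \<le> e" .
  qed
  then show ?thesis using \<sigma>(2) s(3) by simp
qed

text \<open>Expanded form of the positivity of \<open>K\<close> on the signed measure
  \<open>\<sigma> - \<mu>\<close>, with \<open>\<mu>\<close> the measure \<open>vol_S2\<close>. The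
  operator is tested on the mollified density of \<open>\<sigma>\<close> minus 1, and the smoothing
  error is made arbitrarily small by uniform continuity of \<open>K\<close>.\<close>

lemma kernel_positive_on_measures:
  fixes K :: "real^3 \<Rightarrow> real^3 \<Rightarrow> real"
  assumes K: "continuous_on (S2 \<times> S2) (\<lambda>(x, y). K x y)"
    and pos: "positive_operator vol_S2 (integral_operator vol_S2 K)"
    and \<sigma>: "finite_borel_on S2 \<sigma>" "measure \<sigma> S2 = 1"
  shows "(\<integral>x. \<integral>y. K x y \<partial>vol_S2 \<partial>\<sigma>) + (\<integral>x. \<integral>y. K x y \<partial>\<sigma> \<partial>vol_S2)
    \<le> (\<integral>x. \<integral>y. K x y \<partial>\<sigma> \<partial>\<sigma>) + (\<integral>x. \<integral>y. K x y \<partial>vol_S2 \<partial>vol_S2)"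
proof (rule field_le_epsilon)
  fix e' :: real assume "0 < e'"
  \<comment> \<open>Four approximation errors of size at most \<open>e\<close> are added at the
    end.\<close>
  define e where "e = e' / 4"
  have e: "e > 0" using \<open>0 < e'\<close> by (simp add: e_def)
  note s = finite_borel_onD[OF \<sigma>(1)] and v = finite_borel_onD[OF finite_borel_on_vol_S2]
  have "uniformly_continuous_on (S2 \<times> S2) (\<lambda>(x, y). K x y)"
    by (intro compact_uniformly_continuous compact_Times compact_S2 K)
  then obtain r where r: "r > 0"
    "\<And>z z'. z \<in> S2 \<times> S2 \<Longrightarrow> z' \<in> S2 \<times> S2 \<Longrightarrow> dist z' z < r \<Longrightarrow>
       dist ((\<lambda>(x, y). K x y) z') ((\<lambda>(x, y). K x y) z) < e"
    unfolding uniformly_continuous_on_def using e by metis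
  \<comment> \<open>On the sphere the squared distance is \<open>2 - 2 * (x \<bullet> x')\<close>,
    so the cap of depth \<open>r\<^sup>2 / 2\<close> has radius \<open>r\<close>; the bound
    \<open>1 / 2\<close> keeps \<open>d\<close> below 1.\<close>
  define d where "d = min (1 / 2) (r\<^sup>2 / 2)"
  have d: "0 < d" "d < 1" using r(1) by (auto simp: d_def)
  have near: "dist x x' < r" if "x \<in> S2" "x' \<in> S2" "x \<bullet> x' > 1 - d" for x x' :: "real^3"
  proof (rule power2_less_imp_less)
    have "(dist x x')\<^sup>2 = 2 - 2 * (x \<bullet> x')"
      using that by (simp add: dist_norm power2_norm_eq_inner inner_diff inner_commute norm_eq_1)
    also have "\<dots> < 2 * d" using that by simp
    also have "\<dots> \<le> r\<^sup>2" by (simp add: d_def)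
    finally show "(dist x x')\<^sup>2 < r\<^sup>2" .
  qed (use r in simp)
  have osc1: "\<bar>K x y - K x' y\<bar> \<le> e" if "x \<in> S2" "x' \<in> S2" "y \<in> S2" "x \<bullet> x' > 1 - d" for x x' y
    using r(2)[of "(x', y)" "(x, y)"] near[of x x'] that
    by (simp add: dist_real_def dist_Pair_Pair)
  have osc2: "\<bar>K y x - K y x'\<bar> \<le> e" if "x \<in> S2" "x' \<in> S2" "y \<in> S2" "x \<bullet> x' > 1 - d" for x x' y
    using r(2)[of "(y, x')" "(y, x)"] near[of x x'] that
    by (simp add: dist_real_def dist_Pair_Pair)
  define p where "p = mollified_density d \<sigma>"
  have p: "continuous_on S2 p" "p y \<ge> 0" for y
    unfolding p_def using continuous_on_mollified_density[OF \<sigma>(1)] mollified_density_nonneg[OF d] by auto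
  have mol: "\<bar>(\<integral>y. k y * p y \<partial>vol_S2) - (\<integral>x. k x \<partial>\<sigma>)\<bar> \<le> e0"
    if "continuous_on S2 k" "\<And>x y. x \<in> S2 \<Longrightarrow> y \<in> S2 \<Longrightarrow> x \<bullet> y > 1 - d \<Longrightarrow> \<bar>k x - k y\<bar> \<le> e0"
    for k :: "real^3 \<Rightarrow> real" and e0
    unfolding p_def by (rule integral_mollified_density[OF \<sigma> d that])
  \<comment> \<open>Constants have oscillation 0, so mollification preserves the total mass
    exactly.\<close>
  have p1: "(\<integral>y. p y \<partial>vol_S2) = 1"
    using mol[of "\<lambda>_. 1" 0] \<sigma>(2) s by simp
  have Kp: "continuous_on (S2 \<times> S2) (\<lambda>(x, y). K x y * p y)"
    using continuous_on_mult[OF K continuous_on_compose2[OF p(1) continuous_on_snd[OF continuous_on_id]]]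
    by (auto simp: case_prod_unfold)
  \<comment> \<open>The kernel integrated in its second variable against the mollified
    \<open>\<sigma>\<close>, against \<open>vol_S2\<close> and against \<open>\<sigma>\<close>
    itself.\<close>
  define A where "A = (\<lambda>x. \<integral>y. K x y * p y \<partial>vol_S2)"
  define b where "b = (\<lambda>x. \<integral>y. K x y \<partial>vol_S2)"
  define a where "a = (\<lambda>x. \<integral>y. K x y \<partial>\<sigma>)"
  have A: "continuous_on S2 A" unfolding A_def
    by (rule continuous_on_integral_param[OF compact_S2 compact_S2 finite_borel_on_vol_S2 Kp])
  have b: "continuous_on S2 b" unfolding b_def
    by (rule continuous_on_integral_param[OF compact_S2 compact_S2 finite_borel_on_vol_S2 K])
  have a: "continuous_on S2 a" unfolding a_def
    by (rule continuous_on_integral_param[OF compact_S2 compact_S2 \<sigma>(1) K])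
  have Kint: "integrable vol_S2 (K x)" and Kpint: "integrable vol_S2 (\<lambda>y. K x y * p y)" if "x \<in> S2" for x
    using integrable_vol_S2 continuous_on_slices(1)[OF K that] continuous_on_slices(1)[OF Kp that] by auto
  have Aa: "\<bar>A x - a x\<bar> \<le> e" if "x \<in> S2" for x
    unfolding A_def a_def using continuous_on_slices(1)[OF K that] osc2 that by (intro mol)
  \<comment> \<open>Averaging \<open>K\<close> against the probability density \<open>p\<close>
    keeps its oscillation bound, so \<open>A\<close> can itself be tested against
    \<open>p\<close>.\<close>
  have Aosc: "\<bar>A x - A x'\<bar> \<le> e" if "x \<in> S2" "x' \<in> S2" "x \<bullet> x' > 1 - d" for x x'
  proof -
    have "\<bar>A x - A x'\<bar> = \<bar>\<integral>y. K x y * p y - K x' y * p y \<partial>vol_S2\<bar>"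
      using Kpint that by (simp add: A_def)
    also have "\<dots> \<le> (\<integral>y. \<bar>K x y * p y - K x' y * p y\<bar> \<partial>vol_S2)"
      by (rule integral_abs_bound)
    also have "\<dots> \<le> (\<integral>y. e * p y \<partial>vol_S2)"
    proof (rule integral_mono)
      fix y assume "y \<in> space vol_S2"
      then have "\<bar>K x y - K x' y\<bar> * p y \<le> e * p y"
        using osc1 that v(3) p(2) by (intro mult_right_mono) auto
      then show "\<bar>K x y * p y - K x' y * p y\<bar> \<le> e * p y"
        using p(2)[of y] by (simp add: abs_mult flip: left_diff_distrib)
    qed (use Kpint that integrable_vol_S2[OF p(1)] in auto)
    finally show ?thesis using p1 by simp
  qed
  have bosc: "\<bar>b x - b x'\<bar> \<le> e" if "x \<in> S2" "x' \<in> S2" "x \<bullet> x' > 1 - d" for x x'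
    using abs_integral_diff_le[OF v(1) Kint[OF that(1)] Kint[OF that(2)], of e] osc1 that v(3) measure_vol_S2
    by (simp add: b_def)
  \<comment> \<open>The two mollifications in the quadratic term are undone in turn: first the outer
    one, with \<open>A\<close> kept, then the inner one by passing from \<open>A\<close> to
    \<open>a\<close>.\<close>
  have 1: "\<bar>(\<integral>x. A x * p x \<partial>vol_S2) - (\<integral>x. A x \<partial>\<sigma>)\<bar> \<le> e"
    by (rule mol[OF A Aosc])
  have 2: "\<bar>(\<integral>x. A x \<partial>\<sigma>) - (\<integral>x. a x \<partial>\<sigma>)\<bar> \<le> e"
    using abs_integral_diff_le[OF s(1), of A a e] Aa s(3) \<sigma>(2)
      integrable_continuous_compact[OF compact_S2 \<sigma>(1)] A a by simp
  have 3: "\<bar>(\<integral>x. b x * p x \<partial>vol_S2) - (\<integral>x. b x \<partial>\<sigma>)\<bar> \<le> e"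
    by (rule mol[OF b bosc])
  have 4: "\<bar>(\<integral>x. A x \<partial>vol_S2) - (\<integral>x. a x \<partial>vol_S2)\<bar> \<le> e"
    using abs_integral_diff_le[OF v(1), of A a e] Aa v(3) measure_vol_S2 integrable_vol_S2 A a by simp
  \<comment> \<open>The density of mollified \<open>\<sigma>\<close> minus \<open>vol_S2\<close>,
    continuous and hence square integrable.\<close>
  define \<psi> where "\<psi> = (\<lambda>x. p x - 1)"
  have \<psi>: "continuous_on S2 \<psi>" unfolding \<psi>_def by (intro continuous_intros p)
  have "\<psi> \<in> L2 vol_S2"
    unfolding L2_def using borel_measurable_finite_borel_on[OF finite_borel_on_vol_S2 \<psi>]
    by (auto intro!: integrable_vol_S2 continuous_intros \<psi>)
  then have "0 \<le> (\<integral>x. \<psi> x * (\<integral>y. K x y * \<psi> y \<partial>vol_S2) \<partial>vol_S2)"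
    using pos by (simp add: positive_operator_def L2_inner_def integral_operator_def)
  also have "\<dots> = (\<integral>x. A x * p x - A x - (b x * p x - b x) \<partial>vol_S2)"
  proof (rule Bochner_Integration.integral_cong)
    fix x assume "x \<in> space vol_S2"
    then have x: "x \<in> S2" using v(3) by simp
    have *: "(\<integral>y. K x y * \<psi> y \<partial>vol_S2) = A x - b x"
      using Kint[OF x] Kpint[OF x] by (simp add: \<psi>_def right_diff_distrib A_def b_def)
    show "\<psi> x * (\<integral>y. K x y * \<psi> y \<partial>vol_S2) = A x * p x - A x - (b x * p x - b x)"
      unfolding * by (simp add: \<psi>_def algebra_simps)
  qed simp
  also have "\<dots> = (\<integral>x. A x * p x \<partial>vol_S2) - (\<integral>x. A x \<partial>vol_S2)
      - ((\<integral>x. b x * p x \<partial>vol_S2) - (\<integral>x. b x \<partial>vol_S2))"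
    using integrable_vol_S2 A b continuous_on_mult[OF A p(1)] continuous_on_mult[OF b p(1)] by simp
  finally have "(\<integral>x. b x \<partial>\<sigma>) + (\<integral>x. a x \<partial>vol_S2) \<le> (\<integral>x. a x \<partial>\<sigma>) + (\<integral>x. b x \<partial>vol_S2) + e'"
    using 1 2 3 4 unfolding e_def by linarith
  then show "(\<integral>x. \<integral>y. K x y \<partial>vol_S2 \<partial>\<sigma>) + (\<integral>x. \<integral>y. K x y \<partial>\<sigma> \<partial>vol_S2)
    \<le> (\<integral>x. \<integral>y. K x y \<partial>\<sigma> \<partial>\<sigma>) + (\<integral>x. \<integral>y. K x y \<partial>vol_S2 \<partial>vol_S2) + e'"
    by (simp only: a_def b_def)
qed

section \<open>The lower bound for the action\<close>

text \<open>A lower bound for every action bounds the real infimum only over a nonempty set. The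
  Dirac measure at the north pole is a member, regular because of the explicit optimal sets
  \<open>?U\<close> and \<open>?C\<close>.\<close>

lemma normalized_measures_S2_nonempty: "normalized_measures_S2 \<noteq> {}"
proof -
  define a :: "real^3" where "a = axis 3 1"
  have a: "a \<in> S2" by (simp add: a_def)
  note v = finite_borel_onD[OF finite_borel_on_vol_S2]
  \<comment> \<open>A constant map pushes the probability measure \<open>vol_S2\<close> to a Dirac
    measure.\<close>
  define \<delta> where "\<delta> = distr vol_S2 borel_S2 (\<lambda>_. a)"
  have "emeasure vol_S2 S2 = 1"
    using finite_measure.emeasure_eq_measure[OF v(1), of S2] measure_vol_S2 by simp
  moreover have "(\<lambda>_. a) \<in> vol_S2 \<rightarrow>\<^sub>M borel_S2"
    using a by (intro measurable_const) (simp add: space_restrict_space)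
  ultimately have e: "emeasure \<delta> A = indicator A a" if "A \<in> sets borel_S2" for A
    using that v(3) by (cases "a \<in> A") (simp_all add: \<delta>_def emeasure_distr)
  have sub: "A \<subseteq> S2" if "A \<in> sets borel_S2" for A
    using sets.sets_into_space[OF that] by (simp add: space_restrict_space)
  have op: "U \<in> sets borel_S2" if "openin (top_of_set S2) U" for U
    using that by (auto simp: openin_open sets_restrict_space)
  have cl: "C \<in> sets borel_S2" if "compact C" "C \<subseteq> S2" for C
    using that by (auto simp: sets_restrict_space image_iff intro!: bexI[of _ C] borel_compact)
  have out: "emeasure \<delta> A = (INF U\<in>{U. openin (top_of_set S2) U \<and> A \<subseteq> U}. emeasure \<delta> U)"
    if A: "A \<in> sets borel_S2" for A
  proof (rule antisym)
    show "emeasure \<delta> A \<le> (INF U\<in>{U. openin (top_of_set S2) U \<and> A \<subseteq> U}. emeasure \<delta> U)"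
      using op by (intro INF_greatest emeasure_mono) (auto simp: \<delta>_def)
    let ?U = "if a \<in> A then S2 else S2 - {a}"
    have U: "openin (top_of_set S2) ?U" "A \<subseteq> ?U"
      using sub[OF A] by (auto simp: openin_delete)
    then have "(INF U\<in>{U. openin (top_of_set S2) U \<and> A \<subseteq> U}. emeasure \<delta> U) \<le> emeasure \<delta> ?U"
      by (intro INF_lower) auto
    also have "\<dots> \<le> emeasure \<delta> A"
      unfolding e[OF A] e[OF op[OF U(1)]] by simp
    finally show "(INF U\<in>{U. openin (top_of_set S2) U \<and> A \<subseteq> U}. emeasure \<delta> U) \<le> emeasure \<delta> A" .
  qed
  have inn: "emeasure \<delta> A = (SUP C\<in>{C. compact C \<and> C \<subseteq> A}. emeasure \<delta> C)"
    if A: "A \<in> sets borel_S2" for A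
  proof (rule antisym)
    show "(SUP C\<in>{C. compact C \<and> C \<subseteq> A}. emeasure \<delta> C) \<le> emeasure \<delta> A"
      using A by (intro SUP_least emeasure_mono) (auto simp: \<delta>_def)
    let ?C = "if a \<in> A then {a} else {}"
    have C: "compact ?C" "?C \<subseteq> A" by auto
    have "emeasure \<delta> A \<le> emeasure \<delta> ?C"
      unfolding e[OF A] e[OF cl[OF C(1) order_trans[OF C(2) sub[OF A]]]] by simp
    also have "\<dots> \<le> (SUP C\<in>{C. compact C \<and> C \<subseteq> A}. emeasure \<delta> C)"
      using C by (intro SUP_upper) auto
    finally show "emeasure \<delta> A \<le> (SUP C\<in>{C. compact C \<and> C \<subseteq> A}. emeasure \<delta> C)" .
  qed
  have "emeasure \<delta> S2 = 1"
    using e[OF cl[OF compact_S2]] a by simp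
  then have "\<delta> \<in> normalized_measures_S2"
    using out inn by (simp add: normalized_measures_S2_def regular_borel_S2_def \<delta>_def)
  then show ?thesis by blast
qed

lemma finite_borel_on_normalized:
  assumes "\<rho> \<in> normalized_measures_S2"
  shows "finite_borel_on S2 \<rho>" "measure \<rho> S2 = 1"
proof -
  have s: "sets \<rho> = sets borel_S2" and e: "emeasure \<rho> S2 = 1"
    using assms by (auto simp: normalized_measures_S2_def regular_borel_S2_def)
  have "space \<rho> = S2" using sets_eq_imp_space_eq[OF s] by (simp add: space_restrict_space)
  with s e show "finite_borel_on S2 \<rho>"
    by (auto simp: finite_borel_on_def intro!: finite_measureI)
  show "measure \<rho> S2 = 1" using e by (simp add: measure_def)
qed

lemma continuous_on_lagrangian: "continuous_on A (\<lambda>(x, y). lagrangian \<tau> x y)"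
  unfolding lagrangian_def causal_D_def case_prod_unfold by (intro continuous_intros)

lemma double_integral_S2:
  assumes "finite_borel_on S2 M" "continuous_on (S2 \<times> S2) (\<lambda>(x, y). k x y)"
  shows "double_integral M k = (\<integral>x. \<integral>y. k x y \<partial>M \<partial>M)"
  unfolding double_integral_def
  by (rule integral_fst_continuous[OF compact_S2 compact_S2 assms(1,1,2)])

lemma kernel_action_le:
  fixes K :: "real^3 \<Rightarrow> real^3 \<Rightarrow> real"
  assumes K: "continuous_on (S2 \<times> S2) (\<lambda>(x, y). K x y)"
    and le: "\<And>x y. x \<in> S2 \<Longrightarrow> y \<in> S2 \<Longrightarrow> K x y \<le> lagrangian \<tau> x y"
    and pos: "positive_operator vol_S2 (integral_operator vol_S2 K)"
    and \<rho>: "\<rho> \<in> normalized_measures_S2"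
  shows "double_integral vol_S2 K \<le> action \<tau> \<rho>"
proof -
  note r = finite_borel_on_normalized[OF \<rho>]
  note r' = finite_borel_onD[OF r(1)] and v = finite_borel_onD[OF finite_borel_on_vol_S2]
  define q where "q = (\<integral>x. \<integral>y. K x y \<partial>vol_S2 \<partial>vol_S2)"
  \<comment> \<open>\<open>K\<close> need not be symmetric, so both partial means enter the mixed
    terms.\<close>
  define k1 where "k1 = (\<lambda>x. \<integral>y. K x y \<partial>vol_S2)"
  define k2 where "k2 = (\<lambda>x. \<integral>y. K y x \<partial>vol_S2)"
  have k1: "continuous_on S2 k1" unfolding k1_def
    by (rule continuous_on_integral_param[OF compact_S2 compact_S2 finite_borel_on_vol_S2 K])
  have k2: "continuous_on S2 k2" unfolding k2_def
    by (rule continuous_on_integral_param[OF compact_S2 compact_S2 finite_borel_on_vol_S2 continuous_on_swap_args[OF K]])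
  have "continuous_on S2 (\<lambda>x. k1 x + k2 x)" by (intro continuous_intros k1 k2)
  from exists_rotation_integral_ge[OF r this] obtain g where g: "orthogonal_transformation g"
    and ge: "(\<integral>u. k1 u + k2 u \<partial>vol_S2) \<le> (\<integral>x. k1 (g x) + k2 (g x) \<partial>\<rho>)" by blast
  have gS: "g x \<in> S2" if "x \<in> S2" for x
    using g that by (simp add: orthogonal_transformation_norm)
  have gc: "continuous_on UNIV g"
    using g by (intro linear_continuous_on) (simp add: orthogonal_transformation_def linear_conv_bounded_linear)
  have gm: "g \<in> \<rho> \<rightarrow>\<^sub>M borel_S2"
    unfolding measurable_cong_sets[OF r'(2) refl]
    using gS borel_measurable_continuous_onI[OF gc] by (intro measurable_restrict_space3) auto
  define \<sigma> where "\<sigma> = distr \<rho> borel_S2 g"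
  have "g -` S2 \<inter> S2 = S2" using gS by auto
  moreover have "S2 \<in> sets borel_S2"
    using sets.top[of borel_S2] by (simp add: space_restrict_space)
  ultimately have \<sigma>: "finite_borel_on S2 \<sigma>" "measure \<sigma> S2 = 1"
    using gm r r' finite_measure.finite_measure_distr[OF r'(1) gm]
    by (auto simp: \<sigma>_def finite_borel_on_def measure_distr)
  have dist: "(\<integral>x. f x \<partial>\<sigma>) = (\<integral>x. f (g x) \<partial>\<rho>)" if "continuous_on S2 f" for f :: "real^3 \<Rightarrow> real"
    unfolding \<sigma>_def by (rule integral_distr[OF gm borel_measurable_continuous_on_restrict[OF that]])
  have Kg: "continuous_on (S2 \<times> S2) (\<lambda>(x, y). K (g x) (g y))"
  proof -
    have "continuous_on (S2 \<times> S2) (\<lambda>z. (\<lambda>(x, y). K x y) (g (fst z), g (snd z)))"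
      by (rule continuous_on_compose2[OF K])
         (auto intro!: continuous_intros continuous_on_compose2[OF gc] simp: orthogonal_transformation_norm[OF g])
    then show ?thesis by (simp add: case_prod_unfold)
  qed
  have "(\<integral>x. \<integral>y. K x y \<partial>\<sigma> \<partial>\<sigma>) = (\<integral>x. \<integral>y. K (g x) y \<partial>\<sigma> \<partial>\<rho>)"
    by (rule dist[OF continuous_on_integral_param[OF compact_S2 compact_S2 \<sigma>(1) K]])
  also have "\<dots> = (\<integral>x. \<integral>y. K (g x) (g y) \<partial>\<rho> \<partial>\<rho>)"
    using r'(3) by (intro Bochner_Integration.integral_cong refl dist continuous_on_slices(1)[OF K] gS) auto
  \<comment> \<open>The bound of \<open>K\<close> by the Lagrangian is used at the rotated points
    \<open>g x\<close>, \<open>g y\<close>, where the Lagrangian has its value at \<open>x\<close>,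
    \<open>y\<close>.\<close>
  also have "\<dots> \<le> (\<integral>x. \<integral>y. lagrangian \<tau> x y \<partial>\<rho> \<partial>\<rho>)"
  proof (rule integral_mono)
    show "integrable \<rho> (\<lambda>x. \<integral>y. K (g x) (g y) \<partial>\<rho>)"
      by (rule integrable_continuous_compact[OF compact_S2 r(1) continuous_on_integral_param[OF compact_S2 compact_S2 r(1) Kg]])
    show "integrable \<rho> (\<lambda>x. \<integral>y. lagrangian \<tau> x y \<partial>\<rho>)"
      by (rule integrable_continuous_compact[OF compact_S2 r(1)
            continuous_on_integral_param[OF compact_S2 compact_S2 r(1) continuous_on_lagrangian]])
    fix x assume "x \<in> space \<rho>"
    then have x: "x \<in> S2" using r'(3) by simp
    show "(\<integral>y. K (g x) (g y) \<partial>\<rho>) \<le> (\<integral>y. lagrangian \<tau> x y \<partial>\<rho>)"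
    proof (rule integral_mono)
      show "integrable \<rho> (\<lambda>y. K (g x) (g y))"
        by (rule integrable_continuous_compact[OF compact_S2 r(1) continuous_on_slices(1)[OF Kg x]])
      show "integrable \<rho> (\<lambda>y. lagrangian \<tau> x y)"
        by (rule integrable_continuous_compact[OF compact_S2 r(1) continuous_on_slices(1)[OF continuous_on_lagrangian x]])
      fix y assume "y \<in> space \<rho>"
      then have y: "y \<in> S2" using r'(3) by simp
      have "lagrangian \<tau> (g x) (g y) = lagrangian \<tau> x y"
        using g by (simp add: lagrangian_def causal_D_def orthogonal_transformation_def)
      with le[OF gS[OF x] gS[OF y]] show "K (g x) (g y) \<le> lagrangian \<tau> x y" by simp
    qed
  qed
  also have "\<dots> = action \<tau> \<rho>"
    unfolding action_def by (rule double_integral_S2[OF r(1) continuous_on_lagrangian, symmetric])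
  finally have up: "(\<integral>x. \<integral>y. K x y \<partial>\<sigma> \<partial>\<sigma>) \<le> action \<tau> \<rho>" .
  have i: "integrable M k1" "integrable M k2" if "finite_borel_on S2 M" for M
    using integrable_continuous_compact[OF compact_S2 that] k1 k2 by auto
  have q2: "(\<integral>u. k2 u \<partial>M) = (\<integral>x. \<integral>y. K x y \<partial>M \<partial>vol_S2)" if "finite_borel_on S2 M" for M
    unfolding k2_def
    by (rule integral_swap_continuous_measure[OF compact_S2 compact_S2 finite_borel_on_vol_S2 that K, symmetric])
  have "(\<integral>u. k1 u + k2 u \<partial>vol_S2) = 2 * q"
    using i[OF finite_borel_on_vol_S2] q2[OF finite_borel_on_vol_S2] by (simp add: q_def k1_def)
  moreover have "(\<integral>x. k1 (g x) + k2 (g x) \<partial>\<rho>) = (\<integral>x. k1 x \<partial>\<sigma>) + (\<integral>x. k2 x \<partial>\<sigma>)"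
    using dist[OF continuous_on_add[OF k1 k2]] i[OF \<sigma>(1)] by simp
  moreover have "(\<integral>x. k1 x \<partial>\<sigma>) + (\<integral>x. k2 x \<partial>\<sigma>) \<le> (\<integral>x. \<integral>y. K x y \<partial>\<sigma> \<partial>\<sigma>) + q"
    using kernel_positive_on_measures[OF K pos \<sigma>] q2[OF \<sigma>(1)] by (simp only: q_def k1_def)
  \<comment> \<open>The chain is \<open>2 * q\<close> \<le> \<open>\<sigma>\<close>-integral of
    \<open>k1 + k2\<close> \<le> double \<open>\<sigma>\<close>-integral of \<open>K\<close> plus
    \<open>q\<close> \<le> \<open>action \<tau> \<rho> + q\<close>.\<close>
  ultimately have "q \<le> action \<tau> \<rho>" using ge up by linarith
  then show ?thesis
    using double_integral_S2[OF finite_borel_on_vol_S2 K] by (simp add: q_def)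
qed

theorem proposition5p3:
  fixes \<tau> :: real and K :: "real^3 \<Rightarrow> real^3 \<Rightarrow> real"
  assumes "\<tau> \<ge> 1"
    and "continuous_on (S2 \<times> S2) (\<lambda>(x, y). K x y)"
    and "\<And>x y. x \<in> S2 \<Longrightarrow> y \<in> S2 \<Longrightarrow> K x y \<le> lagrangian \<tau> x y"
    and "positive_operator vol_S2 (integral_operator vol_S2 K)"
  shows "min_action \<tau> \<ge> double_integral vol_S2 K"
  unfolding min_action_def
  using kernel_action_le[OF assms(2-4)]
  by (intro cINF_greatest normalized_measures_S2_nonempty)

end
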